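(* On a surface $M$, let $(g_{ij},J_i{}^j)$ be a Kähler structure having Levi-Civita connection $D$, volume form $\Omega_{ij}=J_i{}^pg_{pj}$, and scalar curvature $\mathscr{R}_g$. Let $X_i$ be a nontrivial harmonic one-form. Then, for $\Pi_{ijk}=3X_{(i}g_{jk)}$, the symplectic connection $\nabla=D+\Pi_{ij}{}^k$ satisfies $\rho(\nabla)_i=\rho(D)_i-6\mathscr{R}_gX_i$. In particular, if $g$ has constant curvature, then $\rho(\nabla)_i=-6\mathscr{R}_gX_i$ and $\mathcal{K}(\nabla)=0$.
   Context: Abstract index notation is used; parentheses denote symmetrization with averaging factor, so $3X_{(i}g_{jk)}=X_ig_{jk}+X_jg_{ki}+X_kg_{ij}$. Indices are raised and lowered with $\Omega$ by $X_i=X^p\Omega_{pi}$, $X^i=\Omega^{ip}X_p$, where $\Omega^{ip}\Omega_{pj}=-\delta_j{}^i$; in particular $\Pi_{ij}{}^k=\Omega^{kp}\Pi_{ijp}$. A symplectic connection is a torsion-free affine connection $\nabla$ with $\nabla\Omega=0$. Curvature: $\nabla_i\nabla_jY^k-\nabla_j\nabla_iY^k=R_{ijp}{}^kY^p$, $R_{ij}=R_{pij}{}^p$, $R_{ijkl}=R_{ijk}{}^p\Omega_{pl}$; $\mathscr{R}_g=g^{ij}R_{ij}$ for $D$, with $g^{ij}$ the inverse of $g_{ij}$. The curvature one-form is $\rho(\nabla)_i=2\nabla^pR_{ip}$ and $\mathcal{K}(\nabla)=\nabla^i\nabla^jR_{ij}-\tfrac12R^{ij}R_{ij}+\tfrac14R^{ijkl}R_{ijkl}$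 (in dimension $2$ this equals $\tfrac12\nabla^i\rho_i$). Harmonic means closed and co-closed: $D_{[i}X_{j]}=0$ and $g^{pq}D_pX_q=0$. *)

theory Defs
  imports "HOL-Analysis.Analysis"
begin

section \<open>Smooth manifolds\<close>

text \<open>The notion is meant for open sets.\<close>

fun Ck_on :: "nat \<Rightarrow> ('a::real_normed_vector \<Rightarrow> 'b::real_normed_vector) \<Rightarrow> 'a set \<Rightarrow> bool" where
  "Ck_on 0 f S \<longleftrightarrow> continuous_on S f"
| "Ck_on (Suc k) f S \<longleftrightarrow>
     (\<forall>x\<in>S. f differentiable (at x)) \<and> (\<forall>v. Ck_on k (\<lambda>x. frechet_derivative f (at x) v) S)"

definition smooth_on :: "('a::real_normed_vector \<Rightarrow> 'b::real_normed_vector) \<Rightarrow> 'a set \<Rightarrow> bool" where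
  "smooth_on f S \<longleftrightarrow> (\<forall>k. Ck_on k f S)"

text \<open>A chart is a domain together with a coordinate map; the values of the map outside the domain
  carry no meaning.\<close>

type_synonym ('a, 'n) chart = "'a set \<times> ('a \<Rightarrow> real ^ 'n)"

definition chart_inv :: "('a, 'n::finite) chart \<Rightarrow> real ^ 'n \<Rightarrow> 'a" where
  "chart_inv c = inv_into (fst c) (snd c)"

definition smooth_manifold :: "'a topology \<Rightarrow> ('a, 'n::finite) chart set \<Rightarrow> bool" where
  "smooth_manifold M A \<longleftrightarrow>
     Hausdorff_space M \<and> second_countable M \<and> \<Union> (fst ` A) = topspace M \<and>
     (\<forall>c\<in>A. openin M (fst c) \<and> open (snd c ` fst c) \<and>
        homeomorphic_map (subtopology M (fst c)) (top_of_set (snd c ` fst c)) (snd c)) \<and>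
     (\<forall>c\<in>A. \<forall>d\<in>A. smooth_on (snd d \<circ> chart_inv c) (snd c ` (fst c \<inter> fst d)))"

definition smooth_in :: "('a, 'n::finite) chart \<Rightarrow> ('a \<Rightarrow> real) \<Rightarrow> bool" where
  "smooth_in c f \<longleftrightarrow> smooth_on (f \<circ> chart_inv c) (snd c ` fst c)"

definition pd :: "('a, 'n::finite) chart \<Rightarrow> 'n \<Rightarrow> ('a \<Rightarrow> real) \<Rightarrow> 'a \<Rightarrow> real" where
  "pd c i f p = frechet_derivative (f \<circ> chart_inv c) (at (snd c p)) (axis i 1)"

text \<open>If \<open>x\<close> and \<open>y\<close> are the coordinates of the charts \<open>c\<close> and \<open>d\<close>, then
  \<open>jac d c p i a\<close> is the value at \<open>p\<close> of the derivative of \<open>x\<^sup>a\<close> with respect to \<open>y\<^sup>i\<close>.\<close>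

definition jac :: "('a, 'n::finite) chart \<Rightarrow> ('a, 'n) chart \<Rightarrow> 'a \<Rightarrow> 'n \<Rightarrow> 'n \<Rightarrow> real" where
  "jac d c p i a = pd d i (\<lambda>q. snd c q $ a) p"


section \<open>Tensor fields and connections\<close>

text \<open>Tensor fields and connections are given by their components in the charts of the atlas,
  which are functions on the manifold, subject to the usual transformation laws.
  The arguments of a component function follow the horizontal order of the indices, so that
  \<open>J c p i j\<close> is \<open>J\<^sub>i\<^sup>j\<close>, and \<open>G c p i j k\<close> is the Christoffel symbol with lower indices \<open>i\<close>, \<open>j\<close>
  and upper index \<open>k\<close>: the derivative of the \<open>j\<close>-th coordinate field along the \<open>i\<close>-th one is the
  sum over \<open>k\<close> of \<open>G c p i j k\<close> times the \<open>k\<close>-th one.\<close>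

type_synonym ('a, 'n) tensor1 = "('a, 'n) chart \<Rightarrow> 'a \<Rightarrow> 'n \<Rightarrow> real"
type_synonym ('a, 'n) tensor2 = "('a, 'n) chart \<Rightarrow> 'a \<Rightarrow> 'n \<Rightarrow> 'n \<Rightarrow> real"
type_synonym ('a, 'n) tensor3 = "('a, 'n) chart \<Rightarrow> 'a \<Rightarrow> 'n \<Rightarrow> 'n \<Rightarrow> 'n \<Rightarrow> real"
type_synonym ('a, 'n) tensor4 = "('a, 'n) chart \<Rightarrow> 'a \<Rightarrow> 'n \<Rightarrow> 'n \<Rightarrow> 'n \<Rightarrow> 'n \<Rightarrow> real"
type_synonym ('a, 'n) connection = "('a, 'n) chart \<Rightarrow> 'a \<Rightarrow> 'n \<Rightarrow> 'n \<Rightarrow> 'n \<Rightarrow> real"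

definition one_form :: "('a, 'n::finite) chart set \<Rightarrow> ('a, 'n) tensor1 \<Rightarrow> bool" where
  "one_form A X \<longleftrightarrow>
     (\<forall>c\<in>A. \<forall>i. smooth_in c (\<lambda>p. X c p i)) \<and>
     (\<forall>c\<in>A. \<forall>d\<in>A. \<forall>p\<in>fst c \<inter> fst d. \<forall>i.
        X d p i = (\<Sum>a\<in>UNIV. jac d c p i a * X c p a))"

definition bilinear_form_field :: "('a, 'n::finite) chart set \<Rightarrow> ('a, 'n) tensor2 \<Rightarrow> bool" where
  "bilinear_form_field A T \<longleftrightarrow>
     (\<forall>c\<in>A. \<forall>i j. smooth_in c (\<lambda>p. T c p i j)) \<and>
     (\<forall>c\<in>A. \<forall>d\<in>A. \<forall>p\<in>fst c \<inter> fst d. \<forall>i j.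
        T d p i j = (\<Sum>a\<in>UNIV. \<Sum>b\<in>UNIV. jac d c p i a * jac d c p j b * T c p a b))"

definition endomorphism_field :: "('a, 'n::finite) chart set \<Rightarrow> ('a, 'n) tensor2 \<Rightarrow> bool" where
  "endomorphism_field A T \<longleftrightarrow>
     (\<forall>c\<in>A. \<forall>i j. smooth_in c (\<lambda>p. T c p i j)) \<and>
     (\<forall>c\<in>A. \<forall>d\<in>A. \<forall>p\<in>fst c \<inter> fst d. \<forall>i j.
        T d p i j = (\<Sum>a\<in>UNIV. \<Sum>b\<in>UNIV. jac d c p i a * jac c d p b j * T c p a b))"

definition affine_connection :: "('a, 'n::finite) chart set \<Rightarrow> ('a, 'n) connection \<Rightarrow> bool" where
  "affine_connection A G \<longleftrightarrow>
     (\<forall>c\<in>A. \<forall>i j k. smooth_in c (\<lambda>p. G c p i j k)) \<and>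
     (\<forall>c\<in>A. \<forall>d\<in>A. \<forall>p\<in>fst c \<inter> fst d. \<forall>i j k.
        G d p i j k =
          (\<Sum>e\<in>UNIV. jac c d p e k *
             (pd d i (\<lambda>q. jac d c q j e) p +
              (\<Sum>a\<in>UNIV. \<Sum>b\<in>UNIV. jac d c p i a * jac d c p j b * G c p a b e))))"

definition torsion_free :: "('a, 'n::finite) chart set \<Rightarrow> ('a, 'n) connection \<Rightarrow> bool" where
  "torsion_free A G \<longleftrightarrow> (\<forall>c\<in>A. \<forall>p\<in>fst c. \<forall>i j k. G c p i j k = G c p j i k)"

text \<open>Covariant derivatives; the differentiating index always comes first. The suffix lists the
  positions of the indices of the tensor which is differentiated (\<open>l\<close> lower, \<open>u\<close> upper).\<close>

definition cov_u :: "('a, 'n::finite) connection \<Rightarrow> ('a, 'n) tensor1 \<Rightarrow> ('a, 'n) tensor2" where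
  "cov_u G Y c p i k = pd c i (\<lambda>q. Y c q k) p + (\<Sum>m\<in>UNIV. G c p i m k * Y c p m)"

definition cov_lu :: "('a, 'n::finite) connection \<Rightarrow> ('a, 'n) tensor2 \<Rightarrow> ('a, 'n) tensor3" where
  "cov_lu G T c p i j k = pd c i (\<lambda>q. T c q j k) p
     - (\<Sum>m\<in>UNIV. G c p i j m * T c p m k) + (\<Sum>m\<in>UNIV. G c p i m k * T c p j m)"

definition cov_l :: "('a, 'n::finite) connection \<Rightarrow> ('a, 'n) tensor1 \<Rightarrow> ('a, 'n) tensor2" where
  "cov_l G X c p i j = pd c i (\<lambda>q. X c q j) p - (\<Sum>m\<in>UNIV. G c p i j m * X c p m)"

definition cov_ll :: "('a, 'n::finite) connection \<Rightarrow> ('a, 'n) tensor2 \<Rightarrow> ('a, 'n) tensor3" where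
  "cov_ll G T c p i j k = pd c i (\<lambda>q. T c q j k) p
     - (\<Sum>m\<in>UNIV. G c p i j m * T c p m k) - (\<Sum>m\<in>UNIV. G c p i k m * T c p j m)"

definition cov_lll :: "('a, 'n::finite) connection \<Rightarrow> ('a, 'n) tensor3 \<Rightarrow> ('a, 'n) tensor4" where
  "cov_lll G T c p i j k l = pd c i (\<lambda>q. T c q j k l) p
     - (\<Sum>m\<in>UNIV. G c p i j m * T c p m k l) - (\<Sum>m\<in>UNIV. G c p i k m * T c p j m l)
     - (\<Sum>m\<in>UNIV. G c p i l m * T c p j k m)"


section \<open>Curvature\<close>

definition coord_field :: "'n \<Rightarrow> ('a, 'n::finite) tensor1" where
  "coord_field k c p m = (if m = k then 1 else 0)"

text \<open>\<open>curv G c p i j k l\<close> is \<open>R\<^sub>i\<^sub>j\<^sub>k\<^sup>l\<close>: the Ricci identity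
  \<open>\<nabla>\<^sub>i\<nabla>\<^sub>jY\<^sup>l - \<nabla>\<^sub>j\<nabla>\<^sub>iY\<^sup>l = R\<^sub>i\<^sub>j\<^sub>q\<^sup>lY\<^sup>q\<close> evaluated at the \<open>k\<close>-th coordinate field \<open>Y\<close>. This determines
  the components of the curvature, because the left-hand side is tensorial in \<open>Y\<close> for a
  torsion-free connection.\<close>

definition curv :: "('a, 'n::finite) connection \<Rightarrow> ('a, 'n) tensor4" where
  "curv G c p i j k l =
     cov_lu G (cov_u G (coord_field k)) c p i j l - cov_lu G (cov_u G (coord_field k)) c p j i l"

definition ricci :: "('a, 'n::finite) connection \<Rightarrow> ('a, 'n) tensor2" where
  "ricci G c p i j = (\<Sum>q\<in>UNIV. curv G c p q i j q)"

definition inv_metric :: "('a, 'n::finite) tensor2 \<Rightarrow> ('a, 'n) tensor2" where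
  "inv_metric g c p i j = matrix_inv (\<chi> a b. g c p a b) $ i $ j"

definition scalar_curv ::
    "('a, 'n::finite) tensor2 \<Rightarrow> ('a, 'n) connection \<Rightarrow> ('a, 'n) chart \<Rightarrow> 'a \<Rightarrow> real" where
  "scalar_curv g D c p = (\<Sum>i\<in>UNIV. \<Sum>j\<in>UNIV. inv_metric g c p i j * ricci D c p i j)"

text \<open>\<open>\<Omega>\<^sup>i\<^sup>j\<close> is normalized by \<open>\<Omega>\<^sup>i\<^sup>p\<Omega>\<^sub>p\<^sub>j = - \<delta>\<^sub>j\<^sup>i\<close>, so it is minus the inverse matrix.\<close>

definition Om_up :: "('a, 'n::finite) tensor2 \<Rightarrow> ('a, 'n) tensor2" where
  "Om_up Om c p i j = - matrix_inv (\<chi> a b. Om c p a b) $ i $ j"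

definition raise_last :: "('a, 'n::finite) tensor2 \<Rightarrow> ('a, 'n) tensor3 \<Rightarrow> ('a, 'n) tensor3" where
  "raise_last Om P c p i j k = (\<Sum>q\<in>UNIV. Om_up Om c p k q * P c p i j q)"

definition curv_low :: "('a, 'n::finite) tensor2 \<Rightarrow> ('a, 'n) connection \<Rightarrow> ('a, 'n) tensor4" where
  "curv_low Om G c p i j k l = (\<Sum>q\<in>UNIV. curv G c p i j k q * Om c p q l)"

definition rho :: "('a, 'n::finite) tensor2 \<Rightarrow> ('a, 'n) connection \<Rightarrow> ('a, 'n) tensor1" where
  "rho Om G c p i =
     2 * (\<Sum>q\<in>UNIV. \<Sum>r\<in>UNIV. Om_up Om c p q r * cov_ll G (ricci G) c p r i q)"

definition raise2 :: "('a, 'n::finite) tensor2 \<Rightarrow> ('a, 'n) tensor2 \<Rightarrow> ('a, 'n) tensor2" where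
  "raise2 Om T c p i j =
     (\<Sum>a\<in>UNIV. \<Sum>b\<in>UNIV. Om_up Om c p i a * Om_up Om c p j b * T c p a b)"

definition raise4 :: "('a, 'n::finite) tensor2 \<Rightarrow> ('a, 'n) tensor4 \<Rightarrow> ('a, 'n) tensor4" where
  "raise4 Om T c p i j k l =
     (\<Sum>a\<in>UNIV. \<Sum>b\<in>UNIV. \<Sum>e\<in>UNIV. \<Sum>f\<in>UNIV.
        Om_up Om c p i a * Om_up Om c p j b * Om_up Om c p k e * Om_up Om c p l f * T c p a b e f)"

definition calK ::
    "('a, 'n::finite) tensor2 \<Rightarrow> ('a, 'n) connection \<Rightarrow> ('a, 'n) chart \<Rightarrow> 'a \<Rightarrow> real" where
  "calK Om G c p =
     (\<Sum>i\<in>UNIV. \<Sum>j\<in>UNIV. \<Sum>a\<in>UNIV. \<Sum>b\<in>UNIV.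
        Om_up Om c p i a * Om_up Om c p j b * cov_lll G (cov_ll G (ricci G)) c p a b i j)
     - 1/2 * (\<Sum>i\<in>UNIV. \<Sum>j\<in>UNIV. raise2 Om (ricci G) c p i j * ricci G c p i j)
     + 1/4 * (\<Sum>i\<in>UNIV. \<Sum>j\<in>UNIV. \<Sum>k\<in>UNIV. \<Sum>l\<in>UNIV.
        raise4 Om (curv_low Om G) c p i j k l * curv_low Om G c p i j k l)"


section \<open>Symplectic connections, Kaehler structures and harmonic one-forms\<close>

definition symplectic_connection ::
    "('a, 'n::finite) chart set \<Rightarrow> ('a, 'n) tensor2 \<Rightarrow> ('a, 'n) connection \<Rightarrow> bool" where
  "symplectic_connection A Om G \<longleftrightarrow>
     affine_connection A G \<and> torsion_free A G \<and>
     (\<forall>c\<in>A. \<forall>p\<in>fst c. \<forall>i j k. cov_ll G Om c p i j k = 0)"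

definition riemannian_metric :: "('a, 'n::finite) chart set \<Rightarrow> ('a, 'n) tensor2 \<Rightarrow> bool" where
  "riemannian_metric A g \<longleftrightarrow>
     bilinear_form_field A g \<and>
     (\<forall>c\<in>A. \<forall>p\<in>fst c. (\<forall>i j. g c p i j = g c p j i) \<and>
        (\<forall>v :: real ^ 'n. v \<noteq> 0 \<longrightarrow> (\<Sum>i\<in>UNIV. \<Sum>j\<in>UNIV. g c p i j * v $ i * v $ j) > 0))"

definition levi_civita ::
    "('a, 'n::finite) chart set \<Rightarrow> ('a, 'n) tensor2 \<Rightarrow> ('a, 'n) connection \<Rightarrow> bool" where
  "levi_civita A g D \<longleftrightarrow>
     affine_connection A D \<and> torsion_free A D \<and>
     (\<forall>c\<in>A. \<forall>p\<in>fst c. \<forall>i j k. cov_ll D g c p i j k = 0)"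

definition nijenhuis :: "('a, 'n::finite) tensor2 \<Rightarrow> ('a, 'n) tensor3" where
  "nijenhuis J c p i j k =
     (\<Sum>m\<in>UNIV. J c p i m * pd c m (\<lambda>q. J c q j k) p - J c p j m * pd c m (\<lambda>q. J c q i k) p
        - J c p m k * (pd c i (\<lambda>q. J c q j m) p - pd c j (\<lambda>q. J c q i m) p))"

definition complex_structure :: "('a, 'n::finite) chart set \<Rightarrow> ('a, 'n) tensor2 \<Rightarrow> bool" where
  "complex_structure A J \<longleftrightarrow>
     endomorphism_field A J \<and>
     (\<forall>c\<in>A. \<forall>p\<in>fst c. \<forall>i j.
        (\<Sum>m\<in>UNIV. J c p i m * J c p m j) = (if i = j then - 1 else 0)) \<and>
     (\<forall>c\<in>A. \<forall>p\<in>fst c. \<forall>i j k. nijenhuis J c p i j k = 0)"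

definition kahler_form ::
    "('a, 'n::finite) tensor2 \<Rightarrow> ('a, 'n) tensor2 \<Rightarrow> ('a, 'n) tensor2" where
  "kahler_form g J c p i j = (\<Sum>m\<in>UNIV. J c p i m * g c p m j)"

definition closed_two_form :: "('a, 'n::finite) chart set \<Rightarrow> ('a, 'n) tensor2 \<Rightarrow> bool" where
  "closed_two_form A Om \<longleftrightarrow>
     (\<forall>c\<in>A. \<forall>p\<in>fst c. \<forall>i j k.
        pd c i (\<lambda>q. Om c q j k) p + pd c j (\<lambda>q. Om c q k i) p + pd c k (\<lambda>q. Om c q i j) p = 0)"

definition kahler_structure ::
    "('a, 'n::finite) chart set \<Rightarrow> ('a, 'n) tensor2 \<Rightarrow> ('a, 'n) tensor2 \<Rightarrow> bool" where
  "kahler_structure A g J \<longleftrightarrow>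
     riemannian_metric A g \<and> complex_structure A J \<and>
     (\<forall>c\<in>A. \<forall>p\<in>fst c. \<forall>i j.
        (\<Sum>a\<in>UNIV. \<Sum>b\<in>UNIV. J c p i a * J c p j b * g c p a b) = g c p i j) \<and>
     closed_two_form A (kahler_form g J)"

definition harmonic_one_form ::
    "('a, 'n::finite) chart set \<Rightarrow> ('a, 'n) tensor2 \<Rightarrow> ('a, 'n) connection \<Rightarrow> ('a, 'n) tensor1 \<Rightarrow> bool"
  where
  "harmonic_one_form A g D X \<longleftrightarrow>
     one_form A X \<and>
     (\<forall>c\<in>A. \<forall>p\<in>fst c.
        (\<forall>i j. 1/2 * (cov_l D X c p i j - cov_l D X c p j i) = 0) \<and>
        (\<Sum>i\<in>UNIV. \<Sum>j\<in>UNIV. inv_metric g c p i j * cov_l D X c p i j) = 0)"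

text \<open>The symmetrization is normalized by averaging, so the factor \<open>3\<close> in \<open>3X\<^sub>(\<^sub>ig\<^sub>j\<^sub>k\<^sub>)\<close> leaves the
  plain sum over the cyclic permutations.\<close>

definition three_sym :: "('a, 'n::finite) tensor1 \<Rightarrow> ('a, 'n) tensor2 \<Rightarrow> ('a, 'n) tensor3" where
  "three_sym X g c p i j k = X c p i * g c p j k + X c p j * g c p k i + X c p k * g c p i j"

end

(*
  Everything is local in a chart. Write w for Om^{12}, so that w^2 det g = 1, B = DX and N = |X|^2.
  Since Om is D-parallel and Pi is symmetric, the curvature of nabla = D + Pi differs from that of D
  by DPi and Pi * Pi terms, and as X is harmonic this gives
    Ric(nabla) = (R/2) g + S + 8 X X - 2 N g,
  where S_ij = D_q Pi_ij^q is linear in DX. In rho(nabla), the part of D^p S_ip is a commutator of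
  second derivatives of X, contributing -2 R X_i to rho; the product of Pi with (R/2) g contributes
  -4 R X_i; the terms that are quadratic or cubic in X cancel.
  In dimension two the curvature is determined by the Ricci tensor, so the two quadratic curvature
  terms of K cancel and K is half the divergence of rho. For constant R this is a multiple of the
  Om-trace of dX, which is zero.
*)

theory Submission
  imports Defs
begin

section \<open>Differentiable functions\<close>

text \<open>Components carry no meaning outside the chart domain, so an identity between them can be
  differentiated only as an identity on an open set; hence the congruence lemmas for smoothness and
  for partial derivatives. Inside a chart, ordinary derivatives of \<open>g\<close>,
  \<open>w\<close>, \<open>X\<close> and \<open>DX\<close> are traded for covariant ones plus
  Christoffel terms, which cancel; what remains are polynomial identities between components, true
  modulo \<open>w^2 det g = 1\<close> and the vanishing traces of \<open>DX\<close> and its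
  derivative. The Ricci identities rest on the equality of mixed partial derivatives, proved here
  for the notion \<open>Ck_on\<close>. That \<open>nabla\<close> is a connection concerns changes of
  chart: \<open>Pi\<close> is tensorial, but its last index is raised by the inverse matrix of
  \<open>Om\<close>. On a surface \<open>Om\<close> scales by the Jacobian determinant, and Cramer's
  rule turns the reciprocal determinant into the law of an upper index.\<close>

lemma Ck_on_cong:
  fixes f h :: "'a::real_normed_vector \<Rightarrow> 'b::real_normed_vector"
  assumes "open S" "\<And>x. x \<in> S \<Longrightarrow> f x = h x"
  shows "Ck_on k f S \<longleftrightarrow> Ck_on k h S"
  using assms(2)
proof (induction k arbitrary: f h)
  case 0
  then show ?case by (simp cong: continuous_on_cong)
next
  case (Suc k)
  \<comment> \<open>The hypotheses are symmetric in the two functions, so one implication suffices.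
    Openness of \<open>S\<close> makes the derivative depend only on the values on
    \<open>S\<close>.\<close>
  have imp: "Ck_on (Suc k) h' S" if "Ck_on (Suc k) f' S" and eq: "\<And>x. x \<in> S \<Longrightarrow> f' x = h' x"
    for f' h' :: "'a \<Rightarrow> 'b"
  proof -
    have d: "f' differentiable (at x)" if "x \<in> S" for x
      using \<open>Ck_on (Suc k) f' S\<close> that by simp
    have fr: "frechet_derivative f' (at x) = frechet_derivative h' (at x)" if "x \<in> S" for x
      by (rule frechet_derivative_transform_within_open[OF d \<open>open S\<close>]) (use that eq in auto)
    have "h' differentiable (at x)" if "x \<in> S" for x
      using d[OF that] assms(1) that eq
      by (meson differentiable_def has_derivative_transform_within_open)
    moreover have "Ck_on k (\<lambda>x. frechet_derivative h' (at x) v) S" for v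
      using that(1) Suc.IH[of "\<lambda>x. frechet_derivative f' (at x) v" "\<lambda>x. frechet_derivative h' (at x) v"]
      by (simp add: fr)
    ultimately show ?thesis by simp
  qed
  show ?case using imp[of f h] imp[of h f] Suc.prems by metis
qed

lemma Ck_on_differentiable: "Ck_on (Suc k) f S \<Longrightarrow> x \<in> S \<Longrightarrow> f differentiable (at x)"
  by simp

lemma Ck_on_Suc_imp: "Ck_on (Suc k) f S \<Longrightarrow> Ck_on k f S"
proof (induction k arbitrary: f)
  case 0
  then show ?case
    by (simp add: continuous_at_imp_continuous_on differentiable_imp_continuous_within)
next
  case (Suc k)
  have "\<forall>x\<in>S. f differentiable (at x)" "Ck_on (Suc k) (\<lambda>x. frechet_derivative f (at x) v) S" for v
    using Suc.prems by (auto simp only: Ck_on.simps(2)[of "Suc k"])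
  with Suc.IH show ?case unfolding Ck_on.simps(2)[of k f S] by blast
qed

lemma Ck_on_const: "Ck_on k (\<lambda>_. a) S"
  by (induction k arbitrary: a) auto

lemma frechet_derivative_add:
  assumes "f differentiable (at x)" "h differentiable (at x)"
  shows "frechet_derivative (\<lambda>x. f x + h x) (at x) v
    = frechet_derivative f (at x) v + frechet_derivative h (at x) v"
  using frechet_derivative_at[OF has_derivative_add[OF assms[unfolded frechet_derivative_works]]]
  by (rule fun_cong[OF sym])

lemma frechet_derivative_mult:
  fixes f h :: "'a::real_normed_vector \<Rightarrow> real"
  assumes "f differentiable (at x)" "h differentiable (at x)"
  shows "frechet_derivative (\<lambda>x. f x * h x) (at x) v
    = f x * frechet_derivative h (at x) v + frechet_derivative f (at x) v * h x"
  using frechet_derivative_at[OF has_derivative_mult[OF assms[unfolded frechet_derivative_works]]]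
  by (rule fun_cong[OF sym])

lemma frechet_derivative_inverse:
  fixes f :: "'a::real_normed_vector \<Rightarrow> real"
  assumes "f differentiable (at x)" "f x \<noteq> 0"
  shows "frechet_derivative (\<lambda>x. inverse (f x)) (at x) v
    = - (inverse (f x) * frechet_derivative f (at x) v * inverse (f x))"
  using frechet_derivative_at[OF Deriv.has_derivative_inverse[OF assms(2) assms(1)[unfolded frechet_derivative_works]]]
  by (rule fun_cong[OF sym])

lemma Ck_on_add:
  assumes "open S" "Ck_on k f S" "Ck_on k h S"
  shows "Ck_on k (\<lambda>x. f x + h x) S"
  using assms(2,3)
proof (induction k arbitrary: f h)
  case (Suc k)
  have "Ck_on k (\<lambda>x. frechet_derivative (\<lambda>x. f x + h x) (at x) v) S" for v
    by (subst Ck_on_cong[OF \<open>open S\<close> frechet_derivative_add]) (use Suc in auto)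
  with Suc.prems show ?case by auto
qed (auto intro: continuous_intros)

lemma Ck_on_mult:
  fixes f h :: "'a::real_normed_vector \<Rightarrow> real"
  assumes "open S" "Ck_on k f S" "Ck_on k h S"
  shows "Ck_on k (\<lambda>x. f x * h x) S"
  using assms(2,3)
proof (induction k arbitrary: f h)
  case (Suc k)
  have "Ck_on k (\<lambda>x. frechet_derivative (\<lambda>x. f x * h x) (at x) v) S" for v
    by (subst Ck_on_cong[OF \<open>open S\<close> frechet_derivative_mult])
       (use Suc Ck_on_Suc_imp[OF Suc.prems(1)] Ck_on_Suc_imp[OF Suc.prems(2)] in
         \<open>auto intro!: Ck_on_add[OF \<open>open S\<close>]\<close>)
  with Suc.prems show ?case by auto
qed (auto intro: continuous_intros)

text \<open>The derivative of \<open>1/f\<close> contains \<open>1/f\<close> again, but needs it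
  only at one order lower, so induction on the order closes the loop.\<close>

lemma Ck_on_inverse:
  fixes f :: "'a::real_normed_vector \<Rightarrow> real"
  assumes "open S" "Ck_on k f S" "\<And>x. x \<in> S \<Longrightarrow> f x \<noteq> 0"
  shows "Ck_on k (\<lambda>x. inverse (f x)) S"
  using assms(2)
proof (induction k)
  case (Suc k)
  note IH = Suc.IH[OF Ck_on_Suc_imp[OF Suc.prems]]
  have "Ck_on k (\<lambda>x. frechet_derivative (\<lambda>x. inverse (f x)) (at x) v) S" for v
  proof (subst Ck_on_cong[OF \<open>open S\<close>])
    show "frechet_derivative (\<lambda>x. inverse (f x)) (at x) v
      = (- 1) * (inverse (f x) * frechet_derivative f (at x) v * inverse (f x))" if "x \<in> S" for x
      using that Suc.prems assms(3) by (subst frechet_derivative_inverse) auto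
    show "Ck_on k (\<lambda>x. - 1 * (inverse (f x) * frechet_derivative f (at x) v * inverse (f x))) S"
      using IH Suc.prems by (intro Ck_on_mult Ck_on_const \<open>open S\<close>) auto
  qed
  with Suc.prems show ?case by (auto simp: assms(3) intro!: differentiable_inverse)
qed (auto intro!: continuous_intros simp: assms(3))

text \<open>The second difference of \<open>f\<close> in the directions \<open>u\<close> and \<open>v\<close> is a value of the mixed second
  derivative, by two applications of the mean value theorem.\<close>

lemma second_difference_mvt:
  fixes f :: "'a::real_normed_vector \<Rightarrow> real"
  assumes "t > 0"
    and in_S: "\<And>r s. 0 \<le> r \<Longrightarrow> r \<le> t \<Longrightarrow> 0 \<le> s \<Longrightarrow> s \<le> t \<Longrightarrow> x + r *\<^sub>R u + s *\<^sub>R v \<in> S"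
    and f: "Ck_on 2 f S"
  obtains r s where "0 < r" "r < t" "0 < s" "s < t"
    "f (x + t *\<^sub>R u + t *\<^sub>R v) - f (x + t *\<^sub>R u) - f (x + t *\<^sub>R v) + f x =
      t * t * frechet_derivative (\<lambda>y. frechet_derivative f (at y) u) (at (x + r *\<^sub>R u + s *\<^sub>R v)) v"
proof -
  define f1 where "f1 y = frechet_derivative f (at y) u" for y
  have df: "(f has_derivative frechet_derivative f (at y)) (at y)" if "y \<in> S" for y
    using f that by (simp add: numeral_2_eq_2 frechet_derivative_works[symmetric])
  have df1: "(f1 has_derivative frechet_derivative f1 (at y)) (at y)" if "y \<in> S" for y
    using f that by (simp add: numeral_2_eq_2 frechet_derivative_works[symmetric] f1_def[abs_def])
  have d: "((\<lambda>r. f (x + r *\<^sub>R u + s *\<^sub>R v)) has_real_derivative f1 (x + r *\<^sub>R u + s *\<^sub>R v)) (at r)"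
    if "0 \<le> r" "r \<le> t" "0 \<le> s" "s \<le> t" for r s
  proof -
    have D: "((\<lambda>r. x + r *\<^sub>R u + s *\<^sub>R v) has_derivative (\<lambda>h. h *\<^sub>R u)) (at r)"
      by (auto intro!: derivative_eq_intros)
    have "linear (frechet_derivative f (at (x + r *\<^sub>R u + s *\<^sub>R v)))"
      using df[OF in_S[OF that]] has_derivative_linear by blast
    then show ?thesis
      using has_derivative_compose[OF D df[OF in_S[OF that]]]
      by (simp add: has_field_derivative_def f1_def linear_cmul mult.commute[of _ "frechet_derivative _ _ _"] o_def)
  qed
  have d1: "((\<lambda>s. f1 (x + r *\<^sub>R u + s *\<^sub>R v)) has_real_derivative
      frechet_derivative f1 (at (x + r *\<^sub>R u + s *\<^sub>R v)) v) (at s)"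
    if "0 \<le> r" "r \<le> t" "0 \<le> s" "s \<le> t" for r s
  proof -
    have D: "((\<lambda>s. x + r *\<^sub>R u + s *\<^sub>R v) has_derivative (\<lambda>h. h *\<^sub>R v)) (at s)"
      by (auto intro!: derivative_eq_intros)
    have "linear (frechet_derivative f1 (at (x + r *\<^sub>R u + s *\<^sub>R v)))"
      using df1[OF in_S[OF that]] has_derivative_linear by blast
    then show ?thesis
      using has_derivative_compose[OF D df1[OF in_S[OF that]]]
      by (simp add: has_field_derivative_def linear_cmul mult.commute[of _ "frechet_derivative _ _ _"] o_def)
  qed
  have "((\<lambda>r. f (x + r *\<^sub>R u + t *\<^sub>R v) - f (x + r *\<^sub>R u + 0 *\<^sub>R v)) has_real_derivative
      f1 (x + r *\<^sub>R u + t *\<^sub>R v) - f1 (x + r *\<^sub>R u + 0 *\<^sub>R v)) (at r)" if "0 \<le> r" "r \<le> t" for r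
    by (intro DERIV_diff d) (use that \<open>t > 0\<close> in auto)
  from MVT2[OF \<open>t > 0\<close> this] obtain r where r: "0 < r" "r < t"
    and r_eq: "(f (x + t *\<^sub>R u + t *\<^sub>R v) - f (x + t *\<^sub>R u + 0 *\<^sub>R v))
      - (f (x + 0 *\<^sub>R u + t *\<^sub>R v) - f (x + 0 *\<^sub>R u + 0 *\<^sub>R v))
      = (t - 0) * (f1 (x + r *\<^sub>R u + t *\<^sub>R v) - f1 (x + r *\<^sub>R u + 0 *\<^sub>R v))"
    by blast
  from MVT2[OF \<open>t > 0\<close> d1[of r]] r obtain s where s: "0 < s" "s < t"
    and s_eq: "f1 (x + r *\<^sub>R u + t *\<^sub>R v) - f1 (x + r *\<^sub>R u + 0 *\<^sub>R v)
      = (t - 0) * frechet_derivative f1 (at (x + r *\<^sub>R u + s *\<^sub>R v)) v"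
    by auto
  show thesis
    using that[OF r s] r_eq s_eq by (simp add: f1_def[abs_def])
qed

text \<open>The second difference over a small parallelogram is symmetric in \<open>u\<close> and
  \<open>v\<close>, while the mean value theorem, applied in either order, presents it as a mixed
  derivative at a nearby point. Continuity of both mixed derivatives carries the equality to
  \<open>x\<close>.\<close>

lemma frechet_derivative_commute:
  fixes f :: "'a::real_normed_vector \<Rightarrow> real"
  assumes "open S" "x \<in> S" and f: "Ck_on 2 f S"
  shows "frechet_derivative (\<lambda>y. frechet_derivative f (at y) u) (at x) v
    = frechet_derivative (\<lambda>y. frechet_derivative f (at y) v) (at x) u"
proof (rule ccontr)
  define a where "a y = frechet_derivative (\<lambda>y. frechet_derivative f (at y) u) (at y) v" for y
  define b where "b y = frechet_derivative (\<lambda>y. frechet_derivative f (at y) v) (at y) u" for y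
  assume "\<not> ?thesis"
  then have ne: "dist (a x) (b x) > 0" by (simp add: a_def b_def)
  define e where "e = dist (a x) (b x) / 2"
  have cont: "continuous_on S a" "continuous_on S b"
    using f by (simp_all add: numeral_2_eq_2 a_def[abs_def] b_def[abs_def])
  have lim: "(a \<longlongrightarrow> a x) (nhds x)" "(b \<longlongrightarrow> b x) (nhds x)"
    using cont \<open>open S\<close> \<open>x \<in> S\<close>
    by (simp_all add: continuous_on_eq_continuous_at isCont_def tendsto_at_iff_tendsto_nhds)
  have "eventually (\<lambda>y. dist (a y) (a x) < e \<and> dist (b y) (b x) < e \<and> y \<in> S) (nhds x)"
    using lim \<open>open S\<close> \<open>x \<in> S\<close> ne unfolding e_def
    by (intro eventually_conj tendstoD eventually_nhds_in_open) auto
  then obtain d where "d > 0" and d: "\<And>y. dist y x < d \<Longrightarrow> dist (a y) (a x) < e \<and> dist (b y) (b x) < e \<and> y \<in> S"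
    unfolding eventually_nhds_metric by blast
  \<comment> \<open>Every point of the parallelogram is then within \<open>d / 2\<close> of
    \<open>x\<close>; the \<open>+ 1\<close> keeps the divisor positive when both directions
    vanish.\<close>
  define t where "t = d / (2 * (norm u + norm v + 1))"
  have pos: "norm u + norm v + 1 > 0" by (smt (verit) norm_ge_zero)
  have "t > 0" using \<open>d > 0\<close> pos by (simp add: t_def)
  have near: "dist (x + r *\<^sub>R u + s *\<^sub>R v) x < d" if "0 \<le> r" "r \<le> t" "0 \<le> s" "s \<le> t" for r s
  proof -
    have "dist (x + r *\<^sub>R u + s *\<^sub>R v) x = norm (r *\<^sub>R u + s *\<^sub>R v)"
      by (simp add: dist_norm algebra_simps)
    also have "\<dots> \<le> r * norm u + s * norm v"
      using norm_triangle_ineq[of "r *\<^sub>R u" "s *\<^sub>R v"] that by simp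
    also have "\<dots> \<le> t * norm u + t * norm v"
      using that by (intro add_mono mult_right_mono) auto
    also have "\<dots> \<le> t * (norm u + norm v + 1)"
      using \<open>t > 0\<close> by (simp add: algebra_simps)
    also have "\<dots> = d / 2" unfolding t_def using pos
      by (simp only: times_divide_eq_left) (simp add: field_simps)
    also have "\<dots> < d" using \<open>d > 0\<close> by simp
    finally show ?thesis .
  qed
  have in_S: "x + r *\<^sub>R u + s *\<^sub>R v \<in> S" if "0 \<le> r" "r \<le> t" "0 \<le> s" "s \<le> t" for r s
    using near[OF that] d by blast
  have in_S': "x + r *\<^sub>R v + s *\<^sub>R u \<in> S" if "0 \<le> r" "r \<le> t" "0 \<le> s" "s \<le> t" for r s
    using in_S[OF that(3,4,1,2)] by (simp add: algebra_simps)
  obtain r s where rs: "0 < r" "r < t" "0 < s" "s < t"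
    and 1: "f (x + t *\<^sub>R u + t *\<^sub>R v) - f (x + t *\<^sub>R u) - f (x + t *\<^sub>R v) + f x
      = t * t * a (x + r *\<^sub>R u + s *\<^sub>R v)"
    using second_difference_mvt[OF \<open>t > 0\<close> in_S f] unfolding a_def by blast
  obtain r' s' where rs': "0 < r'" "r' < t" "0 < s'" "s' < t"
    and 2: "f (x + t *\<^sub>R v + t *\<^sub>R u) - f (x + t *\<^sub>R v) - f (x + t *\<^sub>R u) + f x
      = t * t * b (x + r' *\<^sub>R v + s' *\<^sub>R u)"
    using second_difference_mvt[OF \<open>t > 0\<close> in_S' f] unfolding b_def by blast
  have "x + t *\<^sub>R v + t *\<^sub>R u = x + t *\<^sub>R u + t *\<^sub>R v" by simp
  then have "t * t * a (x + r *\<^sub>R u + s *\<^sub>R v) = t * t * b (x + r' *\<^sub>R v + s' *\<^sub>R u)"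
    using 1 2 by (simp only:)
  then have eq: "a (x + r *\<^sub>R u + s *\<^sub>R v) = b (x + r' *\<^sub>R v + s' *\<^sub>R u)" using \<open>t > 0\<close> by simp
  have "dist (a (x + r *\<^sub>R u + s *\<^sub>R v)) (a x) < e" using d near rs by auto
  moreover have "dist (b (x + r' *\<^sub>R v + s' *\<^sub>R u)) (b x) < e"
    using d near[of s' r'] rs' by (simp add: add_ac)
  ultimately have "dist (a x) (b x) < e + e" using eq
    unfolding dist_real_def by linarith
  then show False by (simp add: e_def)
qed

section \<open>Calculus in a chart\<close>

locale smooth_chart =
  fixes c :: "('a, 'n::finite) chart"
  assumes open_image: "open (snd c ` fst c)" and inj: "inj_on (snd c) (fst c)"
begin

abbreviation U where "U \<equiv> fst c"

lemma chart_inv_image [simp]: "p \<in> U \<Longrightarrow> chart_inv c (snd c p) = p"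
  by (simp add: chart_inv_def inj)

lemma smooth_in_cong: "(\<And>q. q \<in> U \<Longrightarrow> f q = h q) \<Longrightarrow> smooth_in c f \<longleftrightarrow> smooth_in c h"
  unfolding smooth_in_def smooth_on_def
  by (subst Ck_on_cong[OF open_image, of "f \<circ> chart_inv c" "h \<circ> chart_inv c"]) auto

lemma smooth_const [simp, intro]: "smooth_in c (\<lambda>_. a)"
  by (simp add: smooth_in_def smooth_on_def o_def Ck_on_const)

lemma smooth_add [simp, intro]: "smooth_in c f \<Longrightarrow> smooth_in c h \<Longrightarrow> smooth_in c (\<lambda>q. f q + h q)"
  by (simp add: smooth_in_def smooth_on_def o_def Ck_on_add[OF open_image])

lemma smooth_mult [simp, intro]: "smooth_in c f \<Longrightarrow> smooth_in c h \<Longrightarrow> smooth_in c (\<lambda>q. f q * h q)"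
  by (simp add: smooth_in_def smooth_on_def o_def Ck_on_mult[OF open_image])

lemma smooth_minus [simp, intro]: "smooth_in c f \<Longrightarrow> smooth_in c (\<lambda>q. - f q)"
  using smooth_mult[OF smooth_const[of "-1"]] by simp

lemma smooth_diff [simp, intro]: "smooth_in c f \<Longrightarrow> smooth_in c h \<Longrightarrow> smooth_in c (\<lambda>q. f q - h q)"
  using smooth_add[OF _ smooth_minus] by simp

lemma smooth_sum [simp, intro]:
  "(\<And>m. m \<in> I \<Longrightarrow> smooth_in c (f m)) \<Longrightarrow> smooth_in c (\<lambda>q. \<Sum>m\<in>I. f m q)"
  by (induction I rule: infinite_finite_induct) auto

lemma smooth_inverse:
  "smooth_in c f \<Longrightarrow> (\<And>q. q \<in> U \<Longrightarrow> f q \<noteq> 0) \<Longrightarrow> smooth_in c (\<lambda>q. inverse (f q))"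
  by (auto simp: smooth_in_def smooth_on_def o_def intro!: Ck_on_inverse[OF open_image])

lemma smooth_differentiable:
  "smooth_in c f \<Longrightarrow> p \<in> U \<Longrightarrow> (f \<circ> chart_inv c) differentiable (at (snd c p))"
  unfolding smooth_in_def smooth_on_def using Ck_on_differentiable[of 0] by blast

lemma smooth_pd [simp, intro]: "smooth_in c f \<Longrightarrow> smooth_in c (pd c i f)"
proof -
  assume f: "smooth_in c f"
  have "Ck_on k (pd c i f \<circ> chart_inv c) (snd c ` U)" for k
  proof (subst Ck_on_cong[OF open_image])
    show "Ck_on k (\<lambda>x. frechet_derivative (f \<circ> chart_inv c) (at x) (axis i 1)) (snd c ` U)"
      using f[unfolded smooth_in_def smooth_on_def, rule_format, of "Suc k"] by simp
  qed (auto simp: pd_def)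
  then show ?thesis by (simp add: smooth_in_def smooth_on_def)
qed

text \<open>The means of differentiating an identity known only on \<open>U\<close>;
  differentiability of one side passes to the other.\<close>

lemma pd_cong:
  assumes "smooth_in c f" "\<And>q. q \<in> U \<Longrightarrow> f q = h q" "p \<in> U"
  shows "pd c i f p = pd c i h p"
  unfolding pd_def
  by (subst frechet_derivative_transform_within_open
        [OF smooth_differentiable[OF assms(1,3)] open_image, of "h \<circ> chart_inv c"])
     (use assms in auto)

lemma pd_const [simp]: "pd c i (\<lambda>_. a) p = 0"
  by (simp add: pd_def o_def)

lemma pd_add [simp]:
  "smooth_in c f \<Longrightarrow> smooth_in c h \<Longrightarrow> p \<in> U \<Longrightarrow>
    pd c i (\<lambda>q. f q + h q) p = pd c i f p + pd c i h p"
  using smooth_differentiable[of f p] smooth_differentiable[of h p]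
  by (simp add: pd_def o_def frechet_derivative_add)

lemma pd_mult [simp]:
  "smooth_in c f \<Longrightarrow> smooth_in c h \<Longrightarrow> p \<in> U \<Longrightarrow>
    pd c i (\<lambda>q. f q * h q) p = f p * pd c i h p + pd c i f p * h p"
  using smooth_differentiable[of f p] smooth_differentiable[of h p]
  by (simp add: pd_def o_def frechet_derivative_mult)

lemma pd_minus [simp]:
  "smooth_in c f \<Longrightarrow> p \<in> U \<Longrightarrow> pd c i (\<lambda>q. - f q) p = - pd c i f p"
  using pd_mult[OF smooth_const[of "-1"], of f p] by simp

lemma pd_diff [simp]:
  "smooth_in c f \<Longrightarrow> smooth_in c h \<Longrightarrow> p \<in> U \<Longrightarrow>
    pd c i (\<lambda>q. f q - h q) p = pd c i f p - pd c i h p"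
  using pd_add[of f "\<lambda>q. - h q" p] by simp

lemma smooth_divide_const [simp, intro]: "smooth_in c f \<Longrightarrow> smooth_in c (\<lambda>q. f q / a)"
  using smooth_mult[OF _ smooth_const[of "1 / a"]] by simp

lemma pd_divide_const [simp]:
  "smooth_in c f \<Longrightarrow> p \<in> U \<Longrightarrow> pd c i (\<lambda>q. f q / a) p = pd c i f p / a"
  using pd_mult[OF _ smooth_const[of "1 / a"], of f p] by simp

lemma pd_commute:
  assumes "smooth_in c f" "p \<in> U"
  shows "pd c i (pd c j f) p = pd c j (pd c i f) p"
proof -
  let ?F = "f \<circ> chart_inv c"
  have F: "Ck_on 2 ?F (snd c ` U)"
    using assms(1) by (simp add: smooth_in_def smooth_on_def)
  \<comment> \<open>\<open>pd c j f\<close> read in the chart agrees with a directional derivative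
    only on the chart image, so the replacement under the outer derivative is made on that open
    set.\<close>
  have *: "pd c i (pd c j f) p
      = frechet_derivative (\<lambda>y. frechet_derivative ?F (at y) (axis j 1)) (at (snd c p)) (axis i 1)" for i j
    unfolding pd_def[of c i]
    by (subst frechet_derivative_transform_within_open
        [OF smooth_differentiable[OF smooth_pd[OF assms(1)] assms(2)] open_image,
         where g = "\<lambda>y. frechet_derivative ?F (at y) (axis j 1)"])
       (use assms(2) in \<open>auto simp: pd_def\<close>)
  show ?thesis
    using frechet_derivative_commute[OF open_image imageI[OF assms(2)] F] by (simp add: *)
qed

end

section \<open>Curvature in a chart\<close>

text \<open>\<open>matrix_inv\<close> chooses some two-sided inverse; uniqueness identifies the
  choice.\<close>

lemma matrix_inv_eqI:
  fixes A B :: "'a::semiring_1 ^ 'n ^ 'n"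
  assumes "A ** B = mat 1" "B ** A = mat 1"
  shows "matrix_inv A = B"
proof -
  have "A ** matrix_inv A = mat 1 \<and> matrix_inv A ** A = mat 1"
    unfolding matrix_inv_def by (rule someI[of _ B]) (use assms in simp)
  then show ?thesis
    by (metis assms(2) matrix_mul_assoc matrix_mul_lid matrix_mul_rid)
qed

lemma matrix_inv_2x2:
  fixes A :: "real ^ 2 ^ 2"
  assumes "A $ 1 $ 1 * A $ 2 $ 2 - A $ 1 $ 2 * A $ 2 $ 1 = d" "d \<noteq> 0"
  shows "matrix_inv A $ 1 $ 1 = A $ 2 $ 2 / d" "matrix_inv A $ 1 $ 2 = - A $ 1 $ 2 / d"
    "matrix_inv A $ 2 $ 1 = - A $ 2 $ 1 / d" "matrix_inv A $ 2 $ 2 = A $ 1 $ 1 / d"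
proof -
  define B :: "real ^ 2 ^ 2" where
    "B = vector [vector [A $ 2 $ 2 / d, - A $ 1 $ 2 / d], vector [- A $ 2 $ 1 / d, A $ 1 $ 1 / d]]"
  have "matrix_inv A = B"
  proof (rule matrix_inv_eqI)
    show "A ** B = mat 1" "B ** A = mat 1"
      using assms by (simp_all add: vec_eq_iff forall_2 matrix_matrix_mult_def sum_2 B_def mat_def vector_2)
        (simp_all add: field_simps)
  qed
  then show "matrix_inv A $ 1 $ 1 = A $ 2 $ 2 / d" "matrix_inv A $ 1 $ 2 = - A $ 1 $ 2 / d"
    "matrix_inv A $ 2 $ 1 = - A $ 2 $ 1 / d" "matrix_inv A $ 2 $ 2 = A $ 1 $ 1 / d"
    by (simp_all add: B_def vector_2)
qed

text \<open>Meant for \<open>r\<close> the Ricci components, \<open>g = (a b; b d)\<close>,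
  \<open>u = 1 / det g\<close> and \<open>s\<close> the scalar curvature. The three relations are
  the skewness of the curvature in its last two indices for the index pairs 11, 22 and 12; they
  force Ricci to be a multiple of the metric.\<close>

lemma einstein_2x2:
  fixes u a b d :: real
  assumes u: "u * (a * d - b * b) = 1"
    and 1: "r21 * a = r11 * b" and 2: "r22 * b = r12 * d"
    and 3: "r21 * b - r11 * d + r22 * a - r12 * b = 0"
  defines "s \<equiv> u * (d * r11 - b * r12 - b * r21 + a * r22)"
  shows "2 * r11 = s * a" "2 * r12 = s * b" "2 * r21 = s * b" "2 * r22 = s * d"
proof -
  have eq: "r12 = r21" using u 1 2 3 by algebra
  show r12: "2 * r12 = s * b" using u 1 2 unfolding eq s_def by algebra
  then show "2 * r21 = s * b" using eq by simp
  have 4: "r22 * a = r11 * d" using 3 eq by simp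
  show "2 * r11 = s * a" using u 1 4 unfolding eq s_def by algebra
  show "2 * r22 = s * d" using u 2 4 unfolding eq s_def by algebra
qed

lemma curv_skew: "curv G c p j i k l = - curv G c p i j k l"
  by (simp add: curv_def)

text \<open>Skewness in the first two indices leaves a single term in the Ricci trace, so in
  dimension two Ricci determines the whole curvature.\<close>

lemma curv_12:
  fixes c :: "('a, 2) chart"
  shows "curv G c p 1 2 j 1 = ricci G c p 2 j" "curv G c p 1 2 j 2 = - ricci G c p 1 j"
  using curv_skew[of G c p 1 1] curv_skew[of G c p 2 2] curv_skew[of G c p 1 2]
  by (simp_all add: ricci_def sum_2)

context smooth_chart begin

abbreviation smooth_conn :: "('a, 'n) connection \<Rightarrow> bool" where
  "smooth_conn G \<equiv> \<forall>i j k. smooth_in c (\<lambda>q. G c q i j k)"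

lemma smooth_cov_l:
  "smooth_conn G \<Longrightarrow> (\<And>i. smooth_in c (\<lambda>q. X c q i)) \<Longrightarrow> smooth_in c (\<lambda>q. cov_l G X c q i j)"
  unfolding cov_l_def by auto

lemma smooth_cov_ll:
  "smooth_conn G \<Longrightarrow> (\<And>i j. smooth_in c (\<lambda>q. T c q i j)) \<Longrightarrow> smooth_in c (\<lambda>q. cov_ll G T c q i j k)"
  unfolding cov_ll_def by auto

lemma smooth_curv:
  "smooth_conn G \<Longrightarrow> smooth_in c (\<lambda>q. curv G c q i j k l)"
  unfolding curv_def cov_lu_def cov_u_def coord_field_def by auto

lemma smooth_ricci:
  "smooth_conn G \<Longrightarrow> smooth_in c (\<lambda>q. ricci G c q i j)"
  unfolding ricci_def by (intro smooth_sum smooth_curv)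

lemma curv_eq:
  assumes G: "smooth_conn G" and sym: "\<And>i j k. G c p i j k = G c p j i k" and p: "p \<in> U"
  shows "curv G c p i j k l = pd c i (\<lambda>q. G c q j k l) p - pd c j (\<lambda>q. G c q i k l) p
    + (\<Sum>m\<in>UNIV. G c p i m l * G c p j k m) - (\<Sum>m\<in>UNIV. G c p j m l * G c p i k m)"
proof -
  \<comment> \<open>A coordinate field has constant components, so its covariant derivative is the
    array of Christoffel symbols. The terms contracted through \<open>G c p i j m\<close> then
    cancel under alternation by symmetry.\<close>
  have "cov_u G (coord_field k) c q i l = G c q i k l" for q i l
    by (simp add: cov_u_def coord_field_def if_distrib sum.delta cong: if_cong)
  then show ?thesis
    by (simp add: curv_def cov_lu_def sym[of j i])
qed

text \<open>The products of \<open>D\<close> with \<open>P\<close> are what completes the partial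
  derivatives of \<open>P\<close> to the covariant derivative \<open>DP\<close>; the remaining part
  of \<open>DP\<close>, contracted through \<open>D c p i j m\<close>, drops out under alternation
  because \<open>D\<close> is symmetric.\<close>

lemma curv_add:
  assumes D: "smooth_conn D" and P: "smooth_conn P"
    and D_sym: "\<And>i j k. D c p i j k = D c p j i k" and P_sym: "\<And>i j k. P c p i j k = P c p j i k"
    and p: "p \<in> U"
  defines "DP \<equiv> \<lambda>a i j k. pd c a (\<lambda>q. P c q i j k) p - (\<Sum>m\<in>UNIV. D c p a i m * P c p m j k)
      - (\<Sum>m\<in>UNIV. D c p a j m * P c p i m k) + (\<Sum>m\<in>UNIV. D c p a m k * P c p i j m)"
  shows "curv (\<lambda>c p i j k. D c p i j k + P c p i j k) c p i j k l
    = curv D c p i j k l + DP i j k l - DP j i k l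
      + (\<Sum>m\<in>UNIV. P c p i m l * P c p j k m) - (\<Sum>m\<in>UNIV. P c p j m l * P c p i k m)"
proof -
  have sm: "\<forall>i j k. smooth_in c (\<lambda>q. D c q i j k + P c q i j k)" using D P by auto
  have sw: "D c p j i m = D c p i j m" "P c p j i m = P c p i j m" for m
    by (rule D_sym P_sym)+
  have sym: "D c p i j k + P c p i j k = D c p j i k + P c p j i k" for i j k
    by (rule arg_cong2[of _ _ _ _ "(+)"]) (rule D_sym P_sym)+
  show ?thesis
    using D P p
    by (simp add: curv_eq[where G = "\<lambda>c p i j k. D c p i j k + P c p i j k", OF sm sym p]
        curv_eq[where G = D, OF D D_sym p] sw DP_def algebra_simps sum.distrib)
qed

end

section \<open>Metrics on surfaces\<close>

text \<open>The only traces of the Kaehler condition are skewness and \<open>\<Omega>\<^sub>1\<^sub>2\<^sup>2 = det g\<close>;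
  on a surface these make \<open>\<Omega>\<close> parallel.\<close>

locale metric_surface_chart = smooth_chart c for c :: "('a, 2) chart" +
  fixes g Om :: "('a, 2) tensor2" and D :: "('a, 2) connection"
  assumes g_smooth [simp, intro]: "smooth_in c (\<lambda>q. g c q i j)"
    and Om_smooth [simp, intro]: "smooth_in c (\<lambda>q. Om c q i j)"
    and D_smooth [simp, intro]: "smooth_in c (\<lambda>q. D c q i j k)"
    and g_sym: "q \<in> U \<Longrightarrow> g c q i j = g c q j i"
    and det_nz: "q \<in> U \<Longrightarrow> g c q 1 1 * g c q 2 2 - (g c q 1 2)\<^sup>2 \<noteq> 0"
    and Om_skew: "q \<in> U \<Longrightarrow> Om c q i j = - Om c q j i"
    and Om_sq: "q \<in> U \<Longrightarrow> (Om c q 1 2)\<^sup>2 = g c q 1 1 * g c q 2 2 - (g c q 1 2)\<^sup>2"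
    and D_sym: "q \<in> U \<Longrightarrow> D c q i j k = D c q j i k"
    and g_parallel: "q \<in> U \<Longrightarrow> cov_ll D g c q i j k = 0"
begin

lemma Om_nz: "q \<in> U \<Longrightarrow> Om c q 1 2 \<noteq> 0"
  using det_nz[of q] Om_sq[of q] by auto

lemma Om_diag [simp]: "q \<in> U \<Longrightarrow> Om c q i i = 0"
  using Om_skew[of q i i] by simp

definition w where "w q = inverse (Om c q 1 2)"

lemma smooth_w [simp, intro]: "smooth_in c w"
  unfolding w_def by (rule smooth_inverse) (auto simp: Om_nz)

lemma w_Om: "q \<in> U \<Longrightarrow> w q * Om c q 1 2 = 1"
  using Om_nz[of q] by (simp add: w_def)

lemma w_sq:
  assumes "q \<in> U"
  shows "w q * w q * (g c q 1 1 * g c q 2 2 - g c q 1 2 * g c q 1 2) = 1"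
  using Om_sq[OF assms] w_Om[OF assms] by algebra

text \<open>The minus sign in \<open>Om_up\<close> cancels the one in the inverse of a skew matrix,
  so the entry 12 is the plain reciprocal of \<open>Om c q 1 2\<close>.\<close>

lemma Om_up_eq:
  assumes "q \<in> U"
  shows "Om_up Om c q 1 2 = w q" "Om_up Om c q 2 1 = - w q"
    "Om_up Om c q 1 1 = 0" "Om_up Om c q 2 2 = 0"
proof -
  let ?A = "\<chi> a b. Om c q a b"
  have "?A $ 1 $ 1 * ?A $ 2 $ 2 - ?A $ 1 $ 2 * ?A $ 2 $ 1 = (Om c q 1 2)\<^sup>2"
    using Om_skew[OF assms, of 2 1] assms by (simp add: power2_eq_square)
  note inv = matrix_inv_2x2[OF this]
  show "Om_up Om c q 1 2 = w q" "Om_up Om c q 2 1 = - w q"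
    "Om_up Om c q 1 1 = 0" "Om_up Om c q 2 2 = 0"
    using Om_nz[OF assms] Om_skew[OF assms, of 2 1] assms
    by (simp_all add: Om_up_def inv w_def power2_eq_square field_simps)
qed

lemma inv_metric_eq:
  assumes "q \<in> U"
  shows "inv_metric g c q 1 1 = w q * w q * g c q 2 2" "inv_metric g c q 1 2 =
    - (w q * w q * g c q 1 2)"
    "inv_metric g c q 2 1 = - (w q * w q * g c q 1 2)" "inv_metric g c q 2 2 = w q * w q * g c q 1 1"
proof -
  let ?A = "\<chi> a b. g c q a b"
  have "?A $ 1 $ 1 * ?A $ 2 $ 2 - ?A $ 1 $ 2 * ?A $ 2 $ 1 = (Om c q 1 2)\<^sup>2"
    using g_sym[OF assms, of 2 1] Om_sq[OF assms] by (simp add: power2_eq_square)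
  note inv = matrix_inv_2x2[OF this]
  show "inv_metric g c q 1 1 = w q * w q * g c q 2 2" "inv_metric g c q 1 2 = - (w q * w q * g c q 1 2)"
    "inv_metric g c q 2 1 = - (w q * w q * g c q 1 2)" "inv_metric g c q 2 2 = w q * w q * g c q 1 1"
    using Om_nz[OF assms] g_sym[OF assms, of 2 1]
    by (simp_all add: inv_metric_def inv w_def power2_eq_square field_simps)
qed

lemma pd_g:
  "q \<in> U \<Longrightarrow> pd c a (\<lambda>q. g c q i j) q = D c q a i 1 * g c q 1 j + D c q a i 2 * g c q 2 j
    + D c q a j 1 * g c q i 1 + D c q a j 2 * g c q i 2"
  using g_parallel[of q a i j] by (simp add: cov_ll_def sum_2)

text \<open>The square of this component is \<open>det g\<close>, whose logarithmic derivative is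
  twice the trace of the Christoffel symbols; dividing by \<open>2 * Om c q 1 2\<close> halves
  it.\<close>

lemma pd_Om:
  assumes q: "q \<in> U"
  shows "pd c a (\<lambda>q. Om c q 1 2) q = (D c q a 1 1 + D c q a 2 2) * Om c q 1 2"
proof -
  have "pd c a (\<lambda>q. Om c q 1 2 * Om c q 1 2) q
    = pd c a (\<lambda>q. g c q 1 1 * g c q 2 2 - g c q 1 2 * g c q 1 2) q"
    by (rule pd_cong) (use q Om_sq in \<open>auto simp: power2_eq_square\<close>)
  then have "2 * Om c q 1 2 * pd c a (\<lambda>q. Om c q 1 2) q
      = 2 * Om c q 1 2 * ((D c q a 1 1 + D c q a 2 2) * Om c q 1 2)"
    using q Om_sq[OF q] g_sym[OF q, of 2 1] by (simp add: pd_g) algebra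
  then show ?thesis using Om_nz[OF q] by simp
qed

lemma pd_w:
  assumes q: "q \<in> U"
  shows "pd c a w q = - ((D c q a 1 1 + D c q a 2 2) * w q)"
proof -
  have "pd c a (\<lambda>q. w q * Om c q 1 2) q = pd c a (\<lambda>q. 1) q"
    by (rule pd_cong) (use q w_Om in auto)
  then have "pd c a w q * Om c q 1 2 = - ((D c q a 1 1 + D c q a 2 2) * w q) * Om c q 1 2"
    using q by (simp add: pd_Om algebra_simps)
  then show ?thesis by (rule mult_right_cancel[OF Om_nz[OF q], THEN iffD1])
qed

lemma Om_parallel:
  assumes q: "q \<in> U"
  shows "cov_ll D Om c q a i j = 0"
proof -
  have "pd c a (\<lambda>q. Om c q 2 1) q = pd c a (\<lambda>q. - Om c q 1 2) q"
    "pd c a (\<lambda>q. Om c q 1 1) q = pd c a (\<lambda>q. 0) q"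
    "pd c a (\<lambda>q. Om c q 2 2) q = pd c a (\<lambda>q. 0) q"
    by (rule pd_cong; use q Om_skew[of _ 2 1] in simp)+
  then have "\<forall>i j. cov_ll D Om c q a i j = 0"
    using q Om_skew[OF q, of 2 1]
    by (simp add: forall_2 cov_ll_def sum_2 pd_Om algebra_simps)
  then show ?thesis by blast
qed

text \<open>Metricity of \<open>D\<close> and the symmetry of the second derivatives of \<open>g\<close> make the curvature
  skew in its last two indices.\<close>

lemma curv_metric_skew:
  assumes p: "p \<in> U"
  shows "(\<Sum>m\<in>UNIV. curv D c p 1 2 i m * g c p m j) + (\<Sum>m\<in>UNIV. curv D c p 1 2 j m * g c p i m) = 0"
proof -
  have ex: "pd c a (pd c b (\<lambda>q. g c q i j)) p =
    pd c a (\<lambda>q. D c q b i 1 * g c q 1 j + D c q b i 2 * g c q 2 j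
    + D c q b j 1 * g c q i 1 + D c q b j 2 * g c q i 2) p" for a b
    by (rule pd_cong) (use p pd_g in auto)
  have "pd c 1 (pd c 2 (\<lambda>q. g c q i j)) p = pd c 2 (pd c 1 (\<lambda>q. g c q i j)) p"
    by (rule pd_commute) (use p in auto)
  then show ?thesis
    using p by (simp add: ex curv_eq[where G = D, OF _ D_sym[OF p]] pd_g sum_2 algebra_simps)
qed

lemma scalar_curv_eq:
  "p \<in> U \<Longrightarrow> scalar_curv g D c p = w p * w p * (g c p 2 2 * ricci D c p 1 1
    - g c p 1 2 * ricci D c p 1 2 - g c p 1 2 * ricci D c p 2 1 + g c p 1 1 * ricci D c p 2 2)"
  by (simp add: scalar_curv_def sum_2 inv_metric_eq algebra_simps)

lemma smooth_scalar_curv [simp, intro]: "smooth_in c (scalar_curv g D c)"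
proof -
  have "smooth_in c (\<lambda>p. w p * w p * (g c p 2 2 * ricci D c p 1 1
    - g c p 1 2 * ricci D c p 1 2 - g c p 1 2 * ricci D c p 2 1 + g c p 1 1 * ricci D c p 2 2))"
    by (simp add: smooth_ricci)
  then show ?thesis
    by (subst smooth_in_cong[OF scalar_curv_eq])
qed

lemma ricci_eq:
  assumes p: "p \<in> U"
  shows "ricci D c p i j = scalar_curv g D c p / 2 * g c p i j"
proof -
  note S = curv_metric_skew[OF p, unfolded sum_2 curv_12]
  have sym: "g c p 2 1 = g c p 1 2" by (rule g_sym[OF p])
  have R: "2 * ricci D c p 1 1 = scalar_curv g D c p * g c p 1 1"
    "2 * ricci D c p 1 2 = scalar_curv g D c p * g c p 1 2"
    "2 * ricci D c p 2 1 = scalar_curv g D c p * g c p 1 2"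
    "2 * ricci D c p 2 2 = scalar_curv g D c p * g c p 2 2"
    unfolding scalar_curv_eq[OF p]
    by (rule einstein_2x2[OF w_sq[OF p]]; use S[of 1 1] S[of 2 2]
      S[of 1 2] sym in \<open>simp add: algebra_simps\<close>)+
  have "\<forall>i j. 2 * ricci D c p i j = scalar_curv g D c p * g c p i j"
    using R sym by (simp add: forall_2)
  then show ?thesis by (simp add: field_simps)
qed

end

section \<open>The connection defined by a harmonic one-form\<close>

text \<open>Here \<open>c\<close> followed by three digits is a component of the second covariant
  derivative of \<open>X = (x, y)\<close>, and \<open>k\<close> is half the scalar curvature. The
  hypotheses are the two traces and the two commutators of second derivatives. Stating it for plain
  reals leaves a polynomial problem for \<open>algebra\<close>.\<close>

lemma contraction_DS_aux:
  fixes w a b d :: real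
  assumes "w * w * (a * d - b * b) = 1"
    and "d * c111 + a * c122 - 2 * b * c112 = 0" "d * c211 + a * c222 - 2 * b * c212 = 0"
    and "c112 - c211 = - (k * b * x - k * a * y)" "c122 - c212 = - (k * d * x - k * b * y)"
  shows "w * (w * (c211 * b + c211 * b - c212 * a - c212 * a)
      - w * (c111 * d + c112 * b - c112 * b - c122 * a)) = - 2 * k * x"
    "w * (w * (c212 * b + c211 * d - c222 * a - c212 * b)
      - w * (c112 * d + c112 * d - c122 * b - c122 * b)) = - 2 * k * y"
  using assms by algebra+

text \<open>Up to sign, the left-hand sides are the \<open>Pi * Pi\<close> part of the Ricci tensor,
  with \<open>p111\<close> to \<open>p222\<close> the components of \<open>Pi\<close>. This is where
  the constants 8 and 2 in the Ricci tensor of \<open>nabla\<close> come from.\<close>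

lemma three_sym_det_aux:
  fixes w a b d x y :: real
  assumes "w * w * (a * d - b * b) = 1"
  defines "N \<equiv> w * w * (d * x * x - 2 * b * x * y + a * y * y)"
    and "p111 \<equiv> x * a + x * a + x * a" and "p112 \<equiv> x * b + x * b + y * a"
    and "p122 \<equiv> x * d + y * b + y * b" and "p222 \<equiv> y * d + y * d + y * d"
  shows "2 * w * w * (p112 * p112) - w * w * (p111 * p122 + p122 * p111) = 2 * (N * a) - 8 * (x * x)"
    "2 * w * w * (p112 * p122) - w * w * (p111 * p222 + p122 * p112) = 2 * (N * b) - 8 * (x * y)"
    "2 * w * w * (p122 * p122) - w * w * (p112 * p222 + p222 * p112) = 2 * (N * d) - 8 * (y * y)"
  unfolding N_def p111_def p112_def p122_def p222_def using assms(1) by algebra+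

locale harmonic_surface_chart = metric_surface_chart c g Om D
  for c :: "('a, 2) chart" and g Om D +
  fixes X :: "('a, 2) tensor1"
  assumes X_smooth [simp, intro]: "smooth_in c (\<lambda>q. X c q i)"
    and closed: "q \<in> U \<Longrightarrow> cov_l D X c q i j = cov_l D X c q j i"
    and coclosed: "q \<in> U \<Longrightarrow> (\<Sum>i\<in>UNIV. \<Sum>j\<in>UNIV. inv_metric g c q i j * cov_l D X c q i j) = 0"
begin

abbreviation B where "B \<equiv> cov_l D X"
abbreviation C where "C \<equiv> cov_ll D (cov_l D X)"
abbreviation P where "P \<equiv> three_sym X g"
abbreviation Q where "Q \<equiv> raise_last Om (three_sym X g)"
abbreviation nabla where "nabla \<equiv> \<lambda>c p i j k. D c p i j k + Q c p i j k"

lemma smooth_B [simp, intro]: "smooth_in c (\<lambda>q. B c q i j)"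
  by (rule smooth_cov_l) auto

lemma smooth_P [simp, intro]: "smooth_in c (\<lambda>q. P c q i j k)"
  unfolding three_sym_def by simp

text \<open>Raising with a skew 2x2 matrix only exchanges the two values of the last index, so no
  sum remains.\<close>

lemma Q_eq: "q \<in> U \<Longrightarrow> Q c q i j 1 = w q * P c q i j 2" "q \<in> U \<Longrightarrow> Q c q i j 2 = - (w q * P c q i j 1)"
  by (simp_all add: raise_last_def sum_2 Om_up_eq)

lemma smooth_Q [simp, intro]: "smooth_in c (\<lambda>q. Q c q i j k)"
proof -
  have "smooth_in c (\<lambda>q. Q c q i j 1)" "smooth_in c (\<lambda>q. Q c q i j 2)"
    by (simp_all add: smooth_in_cong[OF Q_eq(1)] smooth_in_cong[OF Q_eq(2)])
  then have "\<forall>k. smooth_in c (\<lambda>q. Q c q i j k)" by (simp add: forall_2)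
  then show ?thesis by blast
qed

lemma P_sym:
  assumes "q \<in> U"
  shows "P c q i j k = P c q j i k" "P c q i j k = P c q i k j"
  using g_sym[OF assms, of i j] g_sym[OF assms, of i k] g_sym[OF assms, of j k]
  by (simp_all add: three_sym_def)

lemma P_12:
  assumes "q \<in> U"
  shows "P c q 1 2 1 = P c q 1 1 2" "P c q 2 1 1 = P c q 1 1 2" "P c q 2 1 2 = P c q 1 2 2"
    "P c q 2 2 1 = P c q 1 2 2"
  using P_sym[OF assms] by metis+

lemma Q_sym: "q \<in> U \<Longrightarrow> Q c q i j k = Q c q j i k"
  using P_sym(1)[of q i j] by (simp add: raise_last_def)

section \<open>First and second covariant derivatives of the harmonic form\<close>

lemma pd_X: "q \<in> U \<Longrightarrow> pd c a (\<lambda>q. X c q i) q = B c q a i + D c q a i 1 * X c q 1 + D c q a i 2 * X c q 2"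
  by (simp add: cov_l_def sum_2)

lemma pd_B: "q \<in> U \<Longrightarrow> pd c a (\<lambda>q. B c q i j) q = C c q a i j
    + D c q a i 1 * B c q 1 j + D c q a i 2 * B c q 2 j + D c q a j 1 * B c q i 1
      + D c q a j 2 * B c q i 2"
  by (simp add: cov_ll_def sum_2)

lemma C_sym:
  assumes q: "q \<in> U"
  shows "C c q a i j = C c q a j i"
proof -
  have "pd c a (\<lambda>q. B c q i j) q = pd c a (\<lambda>q. B c q j i) q"
    by (rule pd_cong) (use q closed in auto)
  then show ?thesis
    using closed[OF q, of 1 2] closed[OF q, of i 1] closed[OF q, of i 2] closed[OF q, of j 1]
      closed[OF q, of j 2]
    by (simp add: pd_B[OF q])
qed

text \<open>Clearing the factor \<open>w^2\<close> of the inverse metric turns co-closedness into a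
  polynomial relation that can be differentiated directly.\<close>

lemma B_trace:
  assumes q: "q \<in> U"
  shows "g c q 2 2 * B c q 1 1 + g c q 1 1 * B c q 2 2 - 2 * g c q 1 2 * B c q 1 2 = 0"
proof -
  have "w q * w q * (g c q 2 2 * B c q 1 1 + g c q 1 1 * B c q 2 2 - 2 * g c q 1 2 * B c q 1 2) = 0"
    using coclosed[OF q] closed[OF q, of 2 1] by (simp add: sum_2 inv_metric_eq[OF q] algebra_simps)
  then show ?thesis using w_sq[OF q] by auto
qed

text \<open>The expression in \<open>B_trace\<close> is \<open>det g\<close> times the metric trace,
  hence not a scalar: its derivative also contains a multiple of the expression itself, which
  vanishes by \<open>B_trace\<close> again.\<close>

lemma C_trace:
  assumes q: "q \<in> U"
  shows "g c q 2 2 * C c q a 1 1 + g c q 1 1 * C c q a 2 2 - 2 * g c q 1 2 * C c q a 1 2 = 0"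
proof -
  have "pd c a (\<lambda>q. g c q 2 2 * B c q 1 1 + g c q 1 1 * B c q 2 2 - 2 * g c q 1 2 * B c q 1 2) q
    = pd c a (\<lambda>q. 0) q"
    by (rule pd_cong) (use q B_trace in auto)
  then show ?thesis
    using q closed[OF q, of 2 1] C_sym[OF q, of a 2 1] g_sym[OF q, of 2 1] B_trace[OF q]
    by (simp add: pd_g pd_B) algebra
qed

text \<open>The Ricci identity for one-forms: equality of mixed partials of \<open>X\<close> leaves
  the curvature of \<open>D\<close>, which \<open>curv_12\<close> rewrites through Ricci.\<close>

lemma C_commute:
  assumes q: "q \<in> U"
  shows "C c q 1 2 k - C c q 2 1 k =
    - (ricci D c q 2 k * X c q 1 - ricci D c q 1 k * X c q 2)"
proof -
  have ex: "pd c a (pd c b (\<lambda>q. X c q k)) q =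
      pd c a (\<lambda>q. B c q b k + D c q b k 1 * X c q 1 + D c q b k 2 * X c q 2) q" for a b
    by (rule pd_cong) (use q pd_X in auto)
  have "pd c 1 (pd c 2 (\<lambda>q. X c q k)) q = pd c 2 (pd c 1 (\<lambda>q. X c q k)) q"
    by (rule pd_commute) (use q in auto)
  then have "C c q 1 2 k - C c q 2 1 k = - (curv D c q 1 2 k 1 * X c q 1
    + curv D c q 1 2 k 2 * X c q 2)"
    using q D_sym[OF q, of 2 1] unfolding ex
    by (simp add: curv_eq[where G = D, OF _ D_sym[OF q]] pd_X pd_B sum_2 algebra_simps)
  then show ?thesis by (simp add: curv_12)
qed

section \<open>Covariant derivative of Pi and the Ricci tensor of nabla\<close>

lemma cov_P:
  assumes q: "q \<in> U"
  shows "cov_lll D P c q a i j k = B c q a i * g c q j k + B c q a j * g c q k i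
    + B c q a k * g c q i j"
  using q unfolding cov_lll_def three_sym_def sum_2
  by (simp add: pd_X pd_g algebra_simps)

lemma pd_P: "q \<in> U \<Longrightarrow> pd c a (\<lambda>q. P c q i j k) q = cov_lll D P c q a i j k
    + D c q a i 1 * P c q 1 j k + D c q a i 2 * P c q 2 j k
    + D c q a j 1 * P c q i 1 k + D c q a j 2 * P c q i 2 k
    + D c q a k 1 * P c q i j 1 + D c q a k 2 * P c q i j 2"
  by (simp add: cov_lll_def sum_2)

lemma pd_Q:
  assumes q: "q \<in> U"
  shows "pd c a (\<lambda>q. Q c q i j 1) q = w q * pd c a (\<lambda>q. P c q i j 2) q + pd c a w q * P c q i j 2"
    "pd c a (\<lambda>q. Q c q i j 2) q = - (w q * pd c a (\<lambda>q. P c q i j 1) q + pd c a w q * P c q i j 1)"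
proof -
  have "pd c a (\<lambda>q. Q c q i j 1) q = pd c a (\<lambda>q. w q * P c q i j 2) q"
    "pd c a (\<lambda>q. Q c q i j 2) q = pd c a (\<lambda>q. - (w q * P c q i j 1)) q"
    by (rule pd_cong; use q Q_eq in simp)+
  then show "pd c a (\<lambda>q. Q c q i j 1) q = w q * pd c a (\<lambda>q. P c q i j 2) q + pd c a w q * P c q i j 2"
    "pd c a (\<lambda>q. Q c q i j 2) q = - (w q * pd c a (\<lambda>q. P c q i j 1) q + pd c a w q * P c q i j 1)"
    using q by simp_all
qed

text \<open>Raising with the parallel \<open>Om\<close> commutes with \<open>D\<close>. In
  components, the trace term of \<open>pd_w\<close> turns the Christoffel term of the upper index
  into that of the lowered one.\<close>

lemma cov_Q:
  assumes q: "q \<in> U"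
  defines "DQ \<equiv> \<lambda>a i j k. pd c a (\<lambda>q. Q c q i j k) q - (\<Sum>m\<in>UNIV. D c q a i m * Q c q m j k)
      - (\<Sum>m\<in>UNIV. D c q a j m * Q c q i m k) + (\<Sum>m\<in>UNIV. D c q a m k * Q c q i j m)"
  shows "DQ a i j 1 = w q * cov_lll D P c q a i j 2" "DQ a i j 2 = - (w q * cov_lll D P c q a i j 1)"
  unfolding DQ_def sum_2 pd_Q[OF q] Q_eq[OF q] pd_P[OF q] pd_w[OF q] by (simp_all add: algebra_simps)

abbreviation Xsq where
  "Xsq q \<equiv> w q * w q * (g c q 2 2 * X c q 1 * X c q 1 - 2 * g c q 1 2 * X c q 1 * X c q 2
    + g c q 1 1 * X c q 2 * X c q 2)"

lemma curv_nabla: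
  assumes q: "q \<in> U"
  shows "curv nabla c q a b j 1 = curv D c q a b j 1
      + w q * cov_lll D P c q a b j 2 - w q * cov_lll D P c q b a j 2
      + (\<Sum>m\<in>UNIV. Q c q a m 1 * Q c q b j m) - (\<Sum>m\<in>UNIV. Q c q b m 1 * Q c q a j m)"
    "curv nabla c q a b j 2 = curv D c q a b j 2
      - w q * cov_lll D P c q a b j 1 + w q * cov_lll D P c q b a j 1
      + (\<Sum>m\<in>UNIV. Q c q a m 2 * Q c q b j m) - (\<Sum>m\<in>UNIV. Q c q b m 2 * Q c q a j m)"
  using curv_add[of D Q q a b j 1] curv_add[of D Q q a b j 2] D_sym[OF q] Q_sym[OF q] q
  unfolding cov_Q[OF q] by simp_all

lemma ricci_nabla:
  assumes q: "q \<in> U"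
  shows "ricci nabla c q i j = scalar_curv g D c q / 2 * g c q i j
    + w q * (B c q 1 i * g c q 2 j + B c q 1 j * g c q 2 i - B c q 2 i * g c q 1 j
      - B c q 2 j * g c q 1 i)
    + 8 * (X c q i * X c q j) - 2 * (Xsq q * g c q i j)"
proof -
  have sw: "P c q i 2 1 = P c q i 1 2" "P c q 1 j 1 = P c q j 1 1" "P c q 1 j 2 = P c q j 1 2"
    "P c q 2 j 1 = P c q j 1 2" "P c q 2 j 2 = P c q j 2 2"
    using P_sym[OF q] by metis+
  have 1: "ricci nabla c q i j = ricci D c q i j
    + w q * (cov_lll D P c q 1 i j 2 - cov_lll D P c q 2 i j 1)
    - w q * (cov_lll D P c q i 1 j 2 - cov_lll D P c q i 2 j 1)
    - 2 * w q * w q * (P c q i 1 2 * P c q j 1 2) + w q * w q * (P c q i 1 1 * P c q j 2 2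
      + P c q i 2 2 * P c q j 1 1)"
    unfolding ricci_def sum_2 curv_nabla[OF q] Q_eq[OF q]
    by (simp add: P_12[OF q] sw algebra_simps)
  have 2: "\<forall>i j. 2 * w q * w q * (P c q i 1 2 * P c q j 1 2)
      - w q * w q * (P c q i 1 1 * P c q j 2 2 + P c q i 2 2 * P c q j 1 1)
    = 2 * (Xsq q * g c q i j) - 8 * (X c q i * X c q j)"
    using three_sym_det_aux[OF w_sq[OF q], of "X c q 1" "X c q 2"]
    unfolding forall_2 three_sym_def g_sym[OF q, of 2 1] by (simp add: algebra_simps)
  \<comment> \<open>The second difference is the derivative of the \<open>Om\<close>-trace of
    \<open>Pi\<close>, which is zero because \<open>Pi\<close> is symmetric.\<close>
  have 3: "(cov_lll D P c q 1 i j 2 - cov_lll D P c q 2 i j 1)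
    = B c q 1 i * g c q 2 j + B c q 1 j * g c q 2 i - B c q 2 i * g c q 1 j - B c q 2 j * g c q 1 i"
    "cov_lll D P c q i 1 j 2 - cov_lll D P c q i 2 j 1 = 0"
    unfolding cov_P[OF q] g_sym[OF q, of j 1] g_sym[OF q, of j 2] g_sym[OF q, of 2 1]
      closed[OF q, of 2 1]
    by simp_all
  show ?thesis
    using 2[rule_format, of i j] unfolding 1 3 ricci_eq[OF q] by linarith
qed

lemma pd_Xsq:
  assumes q: "q \<in> U"
  shows "pd c r Xsq q = 2 * w q * w q * (g c q 2 2 * X c q 1 * B c q r 1
    - g c q 1 2 * (X c q 1 * B c q r 2 + X c q 2 * B c q r 1) + g c q 1 1 * X c q 2 * B c q r 2)"
  using q g_sym[OF q, of 2 1] by (simp add: pd_g pd_X pd_w algebra_simps)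

text \<open>\<open>w * S\<close> and \<open>E\<close> are the parts of the Ricci tensor of
  \<open>nabla\<close> that are linear in \<open>DX\<close> and quadratic in \<open>X\<close>. Since
  \<open>w\<close> is a component of a parallel tensor, it can stay outside: the covariant
  derivatives are \<open>w * DS\<close> and \<open>DE\<close>.\<close>

abbreviation S where
  "S q i j \<equiv> B c q 1 i * g c q 2 j + B c q 1 j * g c q 2 i - B c q 2 i * g c q 1 j
    - B c q 2 j * g c q 1 i"
abbreviation DS where
  "DS q r i j \<equiv> C c q r 1 i * g c q 2 j + C c q r 1 j * g c q 2 i - C c q r 2 i * g c q 1 j
    - C c q r 2 j * g c q 1 i"
abbreviation E where
  "E q i j \<equiv> 8 * (X c q i * X c q j) - 2 * (Xsq q * g c q i j)"
abbreviation DE where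
  "DE q r i j \<equiv> 8 * (B c q r i * X c q j + X c q i * B c q r j) - 2 * (pd c r Xsq q * g c q i j)"

lemma smooth_ricci_nabla [simp, intro]: "smooth_in c (\<lambda>q. ricci nabla c q i j)"
  by (rule smooth_ricci) auto

lemma cov_ricci_nabla:
  assumes q: "q \<in> U"
  shows "cov_ll D (ricci nabla) c q r i j
    = pd c r (scalar_curv g D c) q / 2 * g c q i j + w q * DS q r i j + DE q r i j"
proof -
  have 2: "pd c r (\<lambda>q. w q * S q i j) q = w q * DS q r i j + w q * (D c q r i 1 * S q 1 j
    + D c q r i 2 * S q 2 j
     + D c q r j 1 * S q i 1 + D c q r j 2 * S q i 2)"
    using q by (simp add: pd_B pd_g pd_w algebra_simps)
  have 3: "pd c r (\<lambda>q. Xsq q * g c q i j) q = pd c r Xsq q * g c q i j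
    + Xsq q * (D c q r i 1 * g c q 1 j + D c q r i 2 * g c q 2 j
     + D c q r j 1 * g c q i 1 + D c q r j 2 * g c q i 2)"
    using q by (subst pd_mult) (simp_all add: pd_g algebra_simps)
  \<comment> \<open>Opaque names keep \<open>simp\<close> from going further than splitting the
    derivative of the sum; each summand is then differentiated on its own.\<close>
  define f where "f = (\<lambda>q. scalar_curv g D c q / 2 * g c q i j)"
  define f' where "f' = (\<lambda>q. w q * S q i j)"
  define f'' where "f'' = (\<lambda>q. X c q i * X c q j)"
  define h where "h = (\<lambda>q. Xsq q * g c q i j)"
  have sm: "smooth_in c f" "smooth_in c f'" "smooth_in c f''" "smooth_in c h"
    unfolding f_def f'_def f''_def h_def by simp_all
  have "pd c r (\<lambda>q. ricci nabla c q i j) q = pd c r (\<lambda>q. f q + f' q + 8 * f'' q - 2 * h q) q"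
    by (rule pd_cong) (use q ricci_nabla in \<open>auto simp: f_def f'_def f''_def h_def\<close>)
  also have "\<dots> = pd c r f q + pd c r f' q + 8 * pd c r f'' q - 2 * pd c r h q"
    using sm q by simp
  finally have 1: "pd c r (\<lambda>q. ricci nabla c q i j) q = \<dots>" .
  have 4: "pd c r f q = pd c r (scalar_curv g D c) q / 2 * g c q i j + scalar_curv g D c q / 2 *
    (D c q r i 1 * g c q 1 j + D c q r i 2 * g c q 2 j + D c q r j 1 * g c q i 1
      + D c q r j 2 * g c q i 2)"
    unfolding f_def using q by (simp add: pd_g)
  have 5: "pd c r f'' q = (B c q r i + D c q r i 1 * X c q 1 + D c q r i 2 * X c q 2) * X c q j
      + X c q i * (B c q r j + D c q r j 1 * X c q 1 + D c q r j 2 * X c q 2)"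
    unfolding f''_def using q by (simp add: pd_X)
  show ?thesis
    unfolding cov_ll_def sum_2 1 4 5 2[folded f'_def] 3[folded h_def] ricci_nabla[OF q]
    by (simp add: algebra_simps)
qed

section \<open>The curvature one-form of nabla\<close>

lemma cov_nabla:
  "cov_ll nabla T c q r i j = cov_ll D T c q r i j - (\<Sum>m\<in>UNIV. Q c q r i m * T c q m j)
    - (\<Sum>m\<in>UNIV. Q c q r j m * T c q i m)"
  by (simp add: cov_ll_def sum_2 algebra_simps)

lemma rho_eq: "q \<in> U \<Longrightarrow> rho Om G c q i = 2 * w q * (cov_ll G (ricci G) c q 2 i 1
  - cov_ll G (ricci G) c q 1 i 2)"
  by (simp add: rho_def sum_2 Om_up_eq algebra_simps)

text \<open>Ricci is \<open>R / 2\<close> times a parallel metric, so only the differential of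
  \<open>R\<close> survives; for constant \<open>R\<close> it vanishes.\<close>

lemma rho_D:
  assumes q: "q \<in> U"
  shows "rho Om D c q i = w q * (pd c 2 (scalar_curv g D c) q * g c q i 1
    - pd c 1 (scalar_curv g D c) q * g c q i 2)"
proof -
  have "cov_ll D (ricci D) c q r i j = pd c r (scalar_curv g D c) q / 2 * g c q i j" for r i j
  proof -
    have "pd c r (\<lambda>q. ricci D c q i j) q = pd c r (\<lambda>q. scalar_curv g D c q / 2 * g c q i j) q"
      by (rule pd_cong) (use q ricci_eq in \<open>simp_all add: smooth_ricci\<close>)
    then show ?thesis
      using q by (simp add: cov_ll_def sum_2 pd_g ricci_eq algebra_simps)
  qed
  then show ?thesis unfolding rho_eq[OF q] by (simp only:) (simp add: algebra_simps)
qed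

lemma contraction_DS:
  assumes q: "q \<in> U"
  shows "w q * (w q * DS q 2 i 1 - w q * DS q 1 i 2) = - scalar_curv g D c q * X c q i"
proof -
  have sym: "C c q r 2 1 = C c q r 1 2" "g c q 2 1 = g c q 1 2" for r
    using C_sym[OF q, of r 2 1] g_sym[OF q, of 2 1] .
  note L = contraction_DS_aux[OF w_sq[OF q] C_trace[OF q, of 1] C_trace[OF q, of 2],
      where k = "scalar_curv g D c q / 2" and x = "X c q 1" and y = "X c q 2",
      OF C_commute[OF q, of 1, unfolded ricci_eq[OF q] sym]
        C_commute[OF q, of 2, unfolded ricci_eq[OF q] sym]]
  have "\<forall>i. w q * (w q * DS q 2 i 1 - w q * DS q 1 i 2) = - scalar_curv g D c q * X c q i"
    using L unfolding forall_2 sym by simp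
  then show ?thesis by blast
qed

text \<open>This is the metric trace of \<open>Pi\<close>: one of its three summands contributes the
  dimension 2, each of the others 1.\<close>

lemma contraction_P_g:
  assumes q: "q \<in> U"
  shows "w q * w q * (P c q 2 i 2 * g c q 1 1 - P c q 2 i 1 * g c q 2 1 - P c q 1 i 2 * g c q 1 2
    + P c q 1 i 1 * g c q 2 2) = 4 * X c q i"
proof -
  have "\<forall>i. w q * w q * (P c q 2 i 2 * g c q 1 1 - P c q 2 i 1 * g c q 2 1
    - P c q 1 i 2 * g c q 1 2 + P c q 1 i 1 * g c q 2 2) = 4 * X c q i"
    using w_sq[OF q] unfolding forall_2 three_sym_def g_sym[OF q, of 2 1] by algebra
  then show ?thesis by blast
qed

text \<open>The contraction evaluates \<open>Pi\<close> twice on the vector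
  \<open>w * (X2, - X1)\<close>, which \<open>X\<close> annihilates and whose squared length is
  \<open>Xsq\<close>; only the summand with the free index on \<open>X\<close> survives.\<close>

lemma contraction_P_XX:
  assumes q: "q \<in> U"
  shows "w q * w q * (P c q 2 i 2 * (X c q 1 * X c q 1) - P c q 2 i 1 * (X c q 2 * X c q 1)
    - P c q 1 i 2 * (X c q 1 * X c q 2) + P c q 1 i 1 * (X c q 2 * X c q 2)) = Xsq q * X c q i"
proof -
  have "\<forall>i. w q * w q * (P c q 2 i 2 * (X c q 1 * X c q 1) - P c q 2 i 1 * (X c q 2 * X c q 1)
    - P c q 1 i 2 * (X c q 1 * X c q 2) + P c q 1 i 1 * (X c q 2 * X c q 2)) = Xsq q * X c q i"
    unfolding forall_2 three_sym_def g_sym[OF q, of 2 1] by (simp add: algebra_simps)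
  then show ?thesis by blast
qed

text \<open>Terms of type \<open>X * DX\<close> enter \<open>rho\<close> both from the divergence of
  \<open>E\<close> and from \<open>Pi\<close> acting on \<open>S\<close>; this equality makes them
  cancel. It uses that \<open>DX\<close> is symmetric and trace-free.\<close>

lemma contraction_DE:
  assumes q: "q \<in> U"
  shows "DE q 2 i 1 - DE q 1 i 2 = w q * w q * (P c q 2 i 2 * S q 1 1 - P c q 2 i 1 * S q 2 1
    - P c q 1 i 2 * S q 1 2 + P c q 1 i 1 * S q 2 2)"
proof -
  have "\<forall>i. DE q 2 i 1 - DE q 1 i 2 = w q * w q * (P c q 2 i 2 * S q 1 1 - P c q 2 i 1 * S q 2 1
    - P c q 1 i 2 * S q 1 2 + P c q 1 i 1 * S q 2 2)"
    using w_sq[OF q] B_trace[OF q] unfolding forall_2 three_sym_def g_sym[OF q, of 2 1]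
      closed[OF q, of 2 1] pd_Xsq[OF q] by algebra
  then show ?thesis by blast
qed

lemma rho_nabla:
  assumes q: "q \<in> U"
  shows "rho Om nabla c q i = rho Om D c q i - 6 * scalar_curv g D c q * X c q i"
proof -
  define R where "R = scalar_curv g D c q"
  \<comment> \<open>Contraction of \<open>Pi\<close> with a two-tensor through two factors of
    \<open>Om_up\<close>; being linear, it can be evaluated on the parts of Ricci
    separately.\<close>
  let ?L = "\<lambda>T. w q * w q * (P c q 2 i 2 * T 1 1 - P c q 2 i 1 * T 2 1 - P c q 1 i 2 * T 1 2
    + P c q 1 i 1 * T 2 2)"
  have "?L (ricci nabla c q) = R / 2 * ?L (g c q) + w q * ?L (S q)
      + 8 * ?L (\<lambda>i j. X c q i * X c q j) - 2 * Xsq q * ?L (g c q)"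
    unfolding ricci_nabla[OF q] R_def by (simp add: algebra_simps)
  \<comment> \<open>The cubic terms cancel: \<open>8 * Xsq q\<close> times \<open>X\<close> from the
    \<open>XX\<close> part against \<open>2 * Xsq q\<close> times the trace \<open>4 * X\<close>
    from the metric part.\<close>
  then have lin: "?L (ricci nabla c q) = 2 * R * X c q i + w q * ?L (S q)"
    unfolding contraction_P_g[OF q] contraction_P_XX[OF q] by simp
  \<comment> \<open>By this symmetry the correction of the last index cancels between the two terms
    of \<open>rho\<close>; the correction of the middle index gives \<open>- 2 * ?L\<close>.\<close>
  have Qs: "Q c q 2 1 m = Q c q 1 2 m" for m by (rule Q_sym[OF q])
  have "rho Om nabla c q i = rho Om D c q i + 2 * (w q * (w q * DS q 2 i 1 - w q * DS q 1 i 2))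
    + 2 * w q * (DE q 2 i 1 - DE q 1 i 2) - 2 * ?L (ricci nabla c q)"
    unfolding rho_eq[OF q, of nabla] rho_D[OF q] cov_nabla cov_ricci_nabla[OF q] sum_2 Qs Q_eq[OF q]
    by (simp add: algebra_simps)
  also have "\<dots> = rho Om D c q i - 6 * scalar_curv g D c q * X c q i"
    unfolding contraction_DS[OF q] contraction_DE[OF q] lin R_def
    by (simp add: algebra_simps)
  finally show ?thesis .
qed

text \<open>Lowering the index of \<open>Q\<close> again turns the correction terms into the
  alternation of \<open>Pi\<close> in its last two indices, which is zero.\<close>

lemma Om_parallel_nabla:
  assumes q: "q \<in> U"
  shows "cov_ll nabla Om c q r i j = 0"
proof -
  have "\<forall>i j. cov_ll nabla Om c q r i j = 0"
    using w_Om[OF q] Om_skew[OF q, of 2 1] P_sym(2)[OF q, of r 2 1] q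
    unfolding forall_2 cov_nabla Om_parallel[OF q] sum_2 Q_eq[OF q]
    by (simp add: algebra_simps)
  then show ?thesis by blast
qed

section \<open>Constant curvature and the vanishing of K\<close>

lemma pd_scalar_curv_const:
  assumes "q \<in> U" "\<And>q. q \<in> U \<Longrightarrow> scalar_curv g D c q = k"
  shows "pd c r (scalar_curv g D c) q = 0"
proof -
  have "pd c r (scalar_curv g D c) q = pd c r (\<lambda>_. k) q"
    by (rule pd_cong) (use assms in auto)
  then show ?thesis by simp
qed

text \<open>By \<open>curv_12\<close> the lowered curvature is \<open>Om\<close> in the first index
  pair times the transposed Ricci tensor. The pairs 12 and 21 contribute equally and
  \<open>w * Om c q 1 2 = 1\<close>, so the full norm is twice the Ricci norm.\<close>

lemma ricci_curv_norm:
  assumes q: "q \<in> U"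
  shows "1/4 * (\<Sum>i\<in>UNIV. \<Sum>j\<in>UNIV. \<Sum>k\<in>UNIV. \<Sum>l\<in>UNIV.
        raise4 Om (curv_low Om G) c q i j k l * curv_low Om G c q i j k l)
    = 1/2 * (\<Sum>i\<in>UNIV. \<Sum>j\<in>UNIV. raise2 Om (ricci G) c q i j * ricci G c q i j)"
proof -
  have R: "curv_low Om G c q 1 2 k 1 = Om c q 1 2 * ricci G c q 1 k"
    "curv_low Om G c q 1 2 k 2 = Om c q 1 2 * ricci G c q 2 k"
    "curv_low Om G c q 2 1 k l = - curv_low Om G c q 1 2 k l"
    "curv_low Om G c q 1 1 k l = 0" "curv_low Om G c q 2 2 k l = 0" for k l
    using q Om_skew[OF q, of 2 1] curv_skew[of G c q 2 1] curv_skew[of G c q 1 1]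
      curv_skew[of G c q 2 2]
    by (simp_all add: curv_low_def sum_2 curv_12)
  have "w q * w q * (Om c q 1 2 * Om c q 1 2) = 1" using w_Om[OF q] by algebra
  then show ?thesis
    unfolding raise4_def raise2_def sum_2 Om_up_eq[OF q] R
    by simp algebra
qed

text \<open>Contraction with \<open>Om\<close> commutes with \<open>nabla\<close>, since
  \<open>nabla\<close> preserves \<open>Om\<close>. The result is written as a one-form field with a
  dummy chart argument, as \<open>cov_l\<close> expects.\<close>

lemma contraction_cov_lll:
  assumes q: "q \<in> U" and T: "\<And>i j k. smooth_in c (\<lambda>q. T c q i j k)"
  shows "w q * (cov_lll nabla T c q a 2 i 1 - cov_lll nabla T c q a 1 i 2)
    = cov_l nabla (\<lambda>_ q i. w q * (T c q 2 i 1 - T c q 1 i 2)) c q a i"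
  using q T P_sym(2)[OF q, of a 2 1]
  unfolding cov_lll_def cov_l_def sum_2 Q_eq[OF q] by (simp add: pd_w algebra_simps)

lemma calK_nabla:
  assumes q: "q \<in> U" and k: "\<And>q. q \<in> U \<Longrightarrow> scalar_curv g D c q = k"
  shows "calK Om nabla c q = 0"
proof -
  define T where "T = cov_ll nabla (ricci nabla)"
  \<comment> \<open>\<open>V\<close> is half of \<open>rho\<close>, so for constant curvature it is
    \<open>- 3 * k\<close> times \<open>X\<close>, and its derivative is known.\<close>
  define V where "V = (\<lambda>(_ :: ('a, 2) chart) q i. w q * (T c q 2 i 1 - T c q 1 i 2))"
  have T: "smooth_in c (\<lambda>q. T c q i j l)" for i j l
    unfolding T_def by (rule smooth_cov_ll) auto
  have V: "smooth_in c (\<lambda>q. V c q i)" for i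
    unfolding V_def using T by simp
  have "V c q i = - 3 * k * X c q i" if "q \<in> U" for q i
    using rho_nabla[OF that, of i] rho_D[OF that] pd_scalar_curv_const[OF that k] k[OF that]
    by (simp add: V_def T_def rho_eq[OF that, of nabla])
  then have "pd c a (\<lambda>q. V c q i) q = pd c a (\<lambda>q. - 3 * k * X c q i) q" for a i
    by (intro pd_cong) (use q V in auto)
  then have pd_V: "pd c a (\<lambda>q. V c q i) q = - 3 * k * pd c a (\<lambda>q. X c q i) q" for a i
    using q by simp
  \<comment> \<open>Alternating the covariant derivative removes the symmetric Christoffel symbols
    of \<open>nabla\<close> and leaves a multiple of \<open>dX\<close>; this alternation is what the
    double divergence amounts to.\<close>
  have "cov_l nabla V c q 2 1 = cov_l nabla V c q 1 2"
    using closed[OF q, of 2 1] D_sym[OF q, of 2 1] Q_sym[OF q, of 2 1]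
    unfolding cov_l_def[of nabla] sum_2 pd_V pd_X[OF q] by simp
  moreover have "(\<Sum>i\<in>UNIV. \<Sum>j\<in>UNIV. \<Sum>a\<in>UNIV. \<Sum>b\<in>UNIV.
        Om_up Om c q i a * Om_up Om c q j b * cov_lll nabla T c q a b i j)
    = w q * (w q * (cov_lll nabla T c q 2 2 1 1 - cov_lll nabla T c q 2 1 1 2)
       - w q * (cov_lll nabla T c q 1 2 2 1 - cov_lll nabla T c q 1 1 2 2))"
    unfolding sum_2 Om_up_eq[OF q] by (simp add: algebra_simps)
  ultimately show ?thesis
    unfolding calK_def ricci_curv_norm[OF q] T_def[symmetric] contraction_cov_lll[of q T, OF q T]
      V_def[symmetric] by simp
qed

end

section \<open>Change of charts\<close>

lemma smooth_manifold_chart: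
  assumes M: "smooth_manifold M A" and c: "c \<in> A"
  shows "smooth_chart c"
proof
  have "openin M (fst c)" and op: "open (snd c ` fst c)"
    and h: "homeomorphic_map (subtopology M (fst c)) (top_of_set (snd c ` fst c)) (snd c)"
    using assms unfolding smooth_manifold_def by blast+
  then have "topspace (subtopology M (fst c)) = fst c"
    using openin_subset[of M "fst c"] by auto
  then show "inj_on (snd c) (fst c)" "open (snd c ` fst c)"
    using homeomorphic_imp_injective_map[OF h] op by simp_all
qed

lemma smooth_manifold_overlap:
  assumes M: "smooth_manifold M A" and c: "c \<in> A" and d: "d \<in> A"
  shows "open (snd c ` (fst c \<inter> fst d))"
    and "x \<in> snd c ` (fst c \<inter> fst d) \<Longrightarrow> (snd d \<circ> chart_inv c) differentiable (at x)"
proof -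
  have open_d: "openin M (fst d)" and op: "open (snd c ` fst c)"
    and h: "homeomorphic_map (subtopology M (fst c)) (top_of_set (snd c ` fst c)) (snd c)"
    using assms unfolding smooth_manifold_def by blast+
  have "openin (subtopology M (fst c)) (fst c \<inter> fst d)"
    using open_d by (metis inf_commute openin_subtopology)
  then have "openin (top_of_set (snd c ` fst c)) (snd c ` (fst c \<inter> fst d))"
    using homeomorphic_imp_open_map[OF h] unfolding open_map_def by blast
  then show "open (snd c ` (fst c \<inter> fst d))"
    using op openin_open_trans by blast
  have "Ck_on (Suc 0) (snd d \<circ> chart_inv c) (snd c ` (fst c \<inter> fst d))"
    using assms unfolding smooth_manifold_def smooth_on_def by blast
  then show "x \<in> snd c ` (fst c \<inter> fst d) \<Longrightarrow> (snd d \<circ> chart_inv c) differentiable (at x)"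
    by (rule Ck_on_differentiable)
qed

lemma jac_eq_frechet_derivative:
  assumes M: "smooth_manifold M A" and c: "c \<in> A" and d: "d \<in> A" and p: "p \<in> fst c \<inter> fst d"
  shows "jac c d p i k = frechet_derivative (snd d \<circ> chart_inv c) (at (snd c p)) (axis i 1) $ k"
proof -
  have "(snd d \<circ> chart_inv c) differentiable (at (snd c p))"
    by (rule smooth_manifold_overlap(2)[OF M c d]) (use p in blast)
  from bounded_linear.has_derivative[OF bounded_linear_vec_nth this[unfolded frechet_derivative_works], of k]
  have "frechet_derivative (\<lambda>x. (snd d \<circ> chart_inv c) x $ k) (at (snd c p))
     = (\<lambda>v. frechet_derivative (snd d \<circ> chart_inv c) (at (snd c p)) v $ k)"
    by (rule frechet_derivative_at[symmetric])
  then show ?thesis by (simp add: jac_def pd_def o_def)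
qed

text \<open>The transition maps compose to the identity on the image of the overlap, which is open,
  so the chain rule makes their derivatives inverse; the sum is this relation in the standard
  basis.\<close>

lemma jac_inverse:
  assumes M: "smooth_manifold M A" and c: "c \<in> A" and d: "d \<in> A" and p: "p \<in> fst c \<inter> fst d"
  shows "(\<Sum>k\<in>UNIV. jac c d p i k * jac d c p k j) = (if i = j then 1 else 0)"
proof -
  interpret c: smooth_chart c by (rule smooth_manifold_chart[OF M c])
  interpret d: smooth_chart d by (rule smooth_manifold_chart[OF M d])
  let ?F = "snd d \<circ> chart_inv c" and ?H = "snd c \<circ> chart_inv d"
  let ?F' = "frechet_derivative ?F (at (snd c p))" and ?H' = "frechet_derivative ?H (at (snd d p))"
  have Fp: "?F (snd c p) = snd d p" using p by simp
  have F: "?F differentiable (at (snd c p))"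
    by (rule smooth_manifold_overlap(2)[OF M c d]) (use p in blast)
  have H: "?H differentiable (at (snd d p))"
    by (rule smooth_manifold_overlap(2)[OF M d c]) (use p in blast)
  have "((?H \<circ> ?F) has_derivative (?H' \<circ> ?F')) (at (snd c p))"
    using F H by (intro diff_chain_at) (simp_all add: frechet_derivative_works[symmetric] Fp del: o_apply)
  moreover have "((?H \<circ> ?F) has_derivative (\<lambda>v. v)) (at (snd c p))"
    by (rule has_derivative_transform_within_open[OF has_derivative_ident smooth_manifold_overlap(1)[OF M c d]])
       (use p in auto)
  ultimately have "?H' \<circ> ?F' = (\<lambda>v. v)" by (rule has_derivative_unique)
  then have id: "?H' (?F' v) = v" for v by (metis o_apply)
  have lin: "linear ?H'" by (rule linear_frechet_derivative[OF H])
  have "?F' (axis i 1) = (\<Sum>k\<in>UNIV. ?F' (axis i 1) $ k *\<^sub>R axis k 1)"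
    using basis_expansion[of "?F' (axis i 1)"] by (simp add: scalar_mult_eq_scaleR)
  then have "axis i 1 $ j = (\<Sum>k\<in>UNIV. ?F' (axis i 1) $ k *\<^sub>R ?H' (axis k 1)) $ j"
    using id[of "axis i 1"] linear_sum[OF lin, of "\<lambda>k. ?F' (axis i 1) $ k *\<^sub>R axis k 1" UNIV]
    by (simp add: linear_scale[OF lin])
  also have "\<dots> = (\<Sum>k\<in>UNIV. jac c d p i k * jac d c p k j)"
    using p by (simp add: jac_eq_frechet_derivative[OF M c d p] jac_eq_frechet_derivative[OF M d c])
  finally show ?thesis by (auto simp: axis_def split: if_splits)
qed

text \<open>The entries of \<open>J g\<close> for \<open>J = (j11 j12; j21 j22)\<close> and \<open>g = (a b; b d)\<close>.\<close>

lemma kahler_form_2x2: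
  fixes a b d j11 j12 j21 j22 :: real
  assumes sq: "j11 * j11 + j12 * j21 = -1" "j11 * j12 + j12 * j22 = 0"
      "j21 * j11 + j22 * j21 = 0" "j21 * j12 + j22 * j22 = -1"
    and herm: "j11 * j11 * a + j11 * j12 * b + (j12 * j11 * b + j12 * j12 * d) = a"
      "j11 * j21 * a + j11 * j22 * b + (j12 * j21 * b + j12 * j22 * d) = b"
      "j21 * j21 * a + j21 * j22 * b + (j22 * j21 * b + j22 * j22 * d) = d"
  shows "j11 * a + j12 * b = 0" "j21 * b + j22 * d = 0" "j11 * b + j12 * d = - (j21 * a + j22 * b)"
    "(j11 * b + j12 * d)\<^sup>2 = a * d - b\<^sup>2"
proof -
  have "j12 \<noteq> 0"
  proof
    assume "j12 = 0"
    with sq(1) have "j11 * j11 = -1" by simp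
    then show False using zero_le_square[of j11] by linarith
  qed
  moreover have "j12 * (j11 + j22) = 0" using sq(2) by algebra
  ultimately have j22: "j22 = - j11" by (simp add: eq_neg_iff_add_eq_0 add.commute)
  define t s r v where om: "t = j11 * a + j12 * b" "s = j11 * b + j12 * d"
    "r = j21 * a + j22 * b" "v = j21 * b + j22 * d"
  \<comment> \<open>With \<open>W = J g\<close>, compatibility reads \<open>J W^T = g\<close>. Hence
    \<open>W = J (J W^T) = - W^T\<close>, which the next three facts verify entry by entry.\<close>
  have h: "j11 * t + j12 * s = a" "j11 * r + j12 * v = b" "j21 * t + j22 * s = b" "j21 * r
    + j22 * v = d"
    using herm by (simp_all add: om algebra_simps)
  have t: "t = 0"
  proof -
    have "t = j11 * (j11 * t + j12 * s) + j12 * (j21 * t + j22 * s)" unfolding h by (rule om)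
    also have "\<dots> = - t" using sq(1,2) by algebra
    finally show ?thesis by simp
  qed
  have v: "v = 0"
  proof -
    have "v = j21 * (j11 * r + j12 * v) + j22 * (j21 * r + j22 * v)" unfolding h by (rule om)
    also have "\<dots> = - v" using sq(3,4) by algebra
    finally show ?thesis by simp
  qed
  have s: "s = - r"
  proof -
    have "s = j11 * (j11 * r + j12 * v) + j12 * (j21 * r + j22 * v)" unfolding h by (rule om)
    also have "\<dots> = - r" using sq(1,2) by algebra
    finally show ?thesis .
  qed
  \<comment> \<open>These are the entries of \<open>g = J W^T\<close> for skew \<open>W\<close>.
    Taking determinants gives the claim, as \<open>J\<close> has determinant 1 by
    \<open>sq(1)\<close> and the vanishing trace.\<close>
  have "a = j12 * s" "b = j22 * s" "d = - j21 * s" using h t v s by auto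
  then have "s * s = a * d - b * b" using sq(1) unfolding j22 by algebra
  then show "j11 * a + j12 * b = 0" "j21 * b + j22 * d = 0" "j11 * b + j12 * d = - (j21 * a + j22 * b)"
    "(j11 * b + j12 * d)\<^sup>2 = a * d - b\<^sup>2"
    using t v s by (simp_all add: om power2_eq_square)
qed

text \<open>Cramer's rule: the determinant of \<open>q\<close> times its inverse \<open>p\<close> is
  the adjugate of \<open>q\<close>.\<close>

lemma inverse_2x2_entries:
  fixes p11 p12 p21 p22 q11 q12 q21 q22 :: real
  assumes "q11 * p11 + q12 * p21 = 1" "q11 * p12 + q12 * p22 = 0"
    "q21 * p11 + q22 * p21 = 0" "q21 * p12 + q22 * p22 = 1"
  shows "(p11 * p22 - p12 * p21) * (q11 * q22 - q12 * q21) = 1"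
    "(q11 * q22 - q12 * q21) * p22 = q11" "(q11 * q22 - q12 * q21) * p21 = - q21"
    "(q11 * q22 - q12 * q21) * p11 = q22" "(q11 * q22 - q12 * q21) * p12 = - q12"
  using assms by algebra+

text \<open>The Jacobians on the upper index of \<open>J\<close> and on the lower index of
  \<open>g\<close> contracted with it are inverse to each other and drop out.\<close>

lemma kahler_form_transform:
  fixes g J :: "('a, 'n::finite) tensor2"
  assumes M: "smooth_manifold M A" and g: "bilinear_form_field A g" and J: "endomorphism_field A J"
    and c: "c \<in> A" and d: "d \<in> A" and p: "p \<in> fst c \<inter> fst d"
  shows "kahler_form g J d p i j
    = (\<Sum>a\<in>UNIV. \<Sum>b\<in>UNIV. jac d c p i a * jac d c p j b * kahler_form g J c p a b)"
proof -
  let ?P = "jac d c p" and ?Q = "jac c d p"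
  have gd': "g d p m j = (\<Sum>e\<in>UNIV. \<Sum>b\<in>UNIV. ?P m e * ?P j b * g c p e b)" for m
    using g c d p unfolding bilinear_form_field_def by blast
  have Jd': "J d p i m = (\<Sum>a\<in>UNIV. \<Sum>f\<in>UNIV. ?P i a * ?Q f m * J c p a f)" for m
    using J c d p unfolding endomorphism_field_def by blast
  define u where "u f = (\<Sum>a\<in>UNIV. ?P i a * J c p a f)" for f
  define v where "v e = (\<Sum>b\<in>UNIV. ?P j b * g c p e b)" for e
  have gd: "g d p m j = (\<Sum>e\<in>UNIV. ?P m e * v e)" for m
    unfolding gd' v_def by (simp add: sum_distrib_left mult.assoc)
  have Jd: "J d p i m = (\<Sum>f\<in>UNIV. u f * ?Q f m)" for m
    unfolding Jd' u_def by (subst sum.swap) (simp add: sum_distrib_left sum_distrib_right mult_ac)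
  have "kahler_form g J d p i j = (\<Sum>m\<in>UNIV. \<Sum>f\<in>UNIV. \<Sum>e\<in>UNIV. u f * v e * (?Q f m * ?P m e))"
    unfolding kahler_form_def gd Jd sum_product by (simp add: mult_ac)
  also have "\<dots> = (\<Sum>f\<in>UNIV. \<Sum>e\<in>UNIV. \<Sum>m\<in>UNIV. u f * v e * (?Q f m * ?P m e))"
    by (subst sum.swap) (intro sum.cong refl sum.swap)
  also have "\<dots> = (\<Sum>f\<in>UNIV. \<Sum>e\<in>UNIV. u f * v e * (if f = e then 1 else 0))"
    unfolding sum_distrib_left[symmetric] jac_inverse[OF M c d p] ..
  also have "\<dots> = (\<Sum>f\<in>UNIV. u f * v f)"
    by (simp add: if_distrib sum.delta cong: if_cong)
  also have "\<dots> = (\<Sum>f\<in>UNIV. \<Sum>a\<in>UNIV. \<Sum>b\<in>UNIV. ?P i a * ?P j b * (J c p a f * g c p f b))"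
    unfolding u_def v_def sum_product by (simp add: mult_ac)
  also have "\<dots> = (\<Sum>a\<in>UNIV. \<Sum>b\<in>UNIV. \<Sum>f\<in>UNIV. ?P i a * ?P j b * (J c p a f * g c p f b))"
    by (subst sum.swap) (intro sum.cong refl sum.swap)
  finally show ?thesis
    by (simp add: kahler_form_def sum_distrib_left)
qed

text \<open>The sum over the last index stands outermost, as in the law of a connection, where the
  raised index will take its place.\<close>

lemma three_sym_transform:
  fixes g :: "('a, 'n::finite) tensor2"
  assumes g: "bilinear_form_field A g" and X: "one_form A X"
    and c: "c \<in> A" and d: "d \<in> A" and p: "p \<in> fst c \<inter> fst d"
  shows "three_sym X g d p i j k = (\<Sum>e\<in>UNIV. jac d c p k e *
    (\<Sum>a\<in>UNIV. \<Sum>b\<in>UNIV. jac d c p i a * jac d c p j b * three_sym X g c p a b e))"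
proof -
  let ?P = "jac d c p"
  have gd: "g d p i j = (\<Sum>a\<in>UNIV. \<Sum>b\<in>UNIV. ?P i a * ?P j b * g c p a b)" for i j
    using g c d p unfolding bilinear_form_field_def by blast
  have Xd: "X d p i = (\<Sum>a\<in>UNIV. ?P i a * X c p a)" for i
    using X c d p unfolding one_form_def by blast
  have 1: "X d p i * g d p j k = (\<Sum>e\<in>UNIV. \<Sum>a\<in>UNIV. \<Sum>b\<in>UNIV. ?P k e * (?P i a * ?P j b * (X c p a * g c p b e)))"
  proof -
    have "X d p i * g d p j k = (\<Sum>a\<in>UNIV. \<Sum>b\<in>UNIV. \<Sum>e\<in>UNIV. ?P k e * (?P i a * ?P j b * (X c p a * g c p b e)))"
      unfolding gd Xd sum_product by (simp add: sum_distrib_left mult_ac)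
    also have "\<dots> = (\<Sum>a\<in>UNIV. \<Sum>e\<in>UNIV. \<Sum>b\<in>UNIV. ?P k e * (?P i a * ?P j b * (X c p a * g c p b e)))"
      by (intro sum.cong refl sum.swap)
    also have "\<dots> = (\<Sum>e\<in>UNIV. \<Sum>a\<in>UNIV. \<Sum>b\<in>UNIV. ?P k e * (?P i a * ?P j b * (X c p a * g c p b e)))"
      by (rule sum.swap)
    finally show ?thesis .
  qed
  have 2: "X d p j * g d p k i = (\<Sum>e\<in>UNIV. \<Sum>a\<in>UNIV. \<Sum>b\<in>UNIV. ?P k e * (?P i a * ?P j b * (X c p b * g c p e a)))"
  proof -
    have "X d p j * g d p k i = (\<Sum>b\<in>UNIV. \<Sum>e\<in>UNIV. \<Sum>a\<in>UNIV. ?P k e * (?P i a * ?P j b * (X c p b * g c p e a)))"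
      unfolding gd Xd sum_product by (simp add: sum_distrib_left mult_ac)
    also have "\<dots> = (\<Sum>e\<in>UNIV. \<Sum>b\<in>UNIV. \<Sum>a\<in>UNIV. ?P k e * (?P i a * ?P j b * (X c p b * g c p e a)))"
      by (rule sum.swap)
    also have "\<dots> = (\<Sum>e\<in>UNIV. \<Sum>a\<in>UNIV. \<Sum>b\<in>UNIV. ?P k e * (?P i a * ?P j b * (X c p b * g c p e a)))"
      by (intro sum.cong refl sum.swap)
    finally show ?thesis .
  qed
  have 3: "X d p k * g d p i j = (\<Sum>e\<in>UNIV. \<Sum>a\<in>UNIV. \<Sum>b\<in>UNIV. ?P k e * (?P i a * ?P j b * (X c p e * g c p a b)))"
    unfolding gd Xd sum_product by (simp add: sum_distrib_left mult_ac)
  show ?thesis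
    unfolding three_sym_def 1 2 3
    by (simp add: sum.distrib[symmetric] sum_distrib_left distrib_left)
qed

section \<open>From the global structures to a single chart\<close>

lemma metric_surface_chart_kahler:
  fixes A :: "('a, 2) chart set"
  assumes M: "smooth_manifold M A" and K: "kahler_structure A g J" and D: "levi_civita A g D"
    and c: "c \<in> A"
  shows "metric_surface_chart c g (kahler_form g J) D"
proof -
  interpret smooth_chart c by (rule smooth_manifold_chart[OF M c])
  have g: "smooth_in c (\<lambda>q. g c q i j)" for i j
    using K c unfolding kahler_structure_def riemannian_metric_def bilinear_form_field_def by blast
  have J: "smooth_in c (\<lambda>q. J c q i j)" for i j
    using K c unfolding kahler_structure_def complex_structure_def endomorphism_field_def by blast
  have sym: "g c q i j = g c q j i" if "q \<in> fst c" for q i j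
    using K c that unfolding kahler_structure_def riemannian_metric_def by blast
  have pos: "(\<Sum>i\<in>UNIV. \<Sum>j\<in>UNIV. g c q i j * v $ i * v $ j) > 0" if "q \<in> fst c" "v \<noteq> 0" for q
    and v :: "real ^ 2"
    using K c that unfolding kahler_structure_def riemannian_metric_def by blast
  have J_sq: "(\<Sum>m\<in>UNIV. J c q i m * J c q m j) = (if i = j then - 1 else 0)" if "q \<in> fst c" for q i j
    using K c that unfolding kahler_structure_def complex_structure_def by blast
  have herm: "(\<Sum>a\<in>UNIV. \<Sum>b\<in>UNIV. J c q i a * J c q j b * g c q a b) = g c q i j" if "q \<in> fst c"
    for q i j
    using K c that unfolding kahler_structure_def by blast
  have Om: "kahler_form g J c q i j = - kahler_form g J c q j i"
      "(kahler_form g J c q 1 2)\<^sup>2 = g c q 1 1 * g c q 2 2 - (g c q 1 2)\<^sup>2" if q: "q \<in> fst c" for q i j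
  proof -
    note k = kahler_form_2x2[where ?j11.0 = "J c q 1 1" and ?j12.0 = "J c q 1 2" and ?j21.0
      = "J c q 2 1" and ?j22.0 = "J c q 2 2"
      and a = "g c q 1 1" and b = "g c q 1 2" and d = "g c q 2 2",
      OF J_sq[OF q, of 1 1, unfolded sum_2, simplified] J_sq[OF q, of 1 2, unfolded sum_2, simplified]
       J_sq[OF q, of 2 1, unfolded sum_2, simplified] J_sq[OF q, of 2 2, unfolded sum_2, simplified]
       herm[OF q, of 1 1, unfolded sum_2 sym[OF q, of 2 1]]
         herm[OF q, of 1 2, unfolded sum_2 sym[OF q, of 2 1]]
       herm[OF q, of 2 2, unfolded sum_2 sym[OF q, of 2 1]]]
    have "\<forall>i j. kahler_form g J c q i j = - kahler_form g J c q j i"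
      unfolding forall_2 kahler_form_def sum_2 sym[OF q, of 2 1] using k by simp
    then show "kahler_form g J c q i j = - kahler_form g J c q j i" by blast
    show "(kahler_form g J c q 1 2)\<^sup>2 = g c q 1 1 * g c q 2 2 - (g c q 1 2)\<^sup>2"
      unfolding kahler_form_def sum_2 using k by simp
  qed
  have det: "g c q 1 1 * g c q 2 2 - (g c q 1 2)\<^sup>2 \<noteq> 0" if q: "q \<in> fst c" for q
  proof
    assume det0: "g c q 1 1 * g c q 2 2 - (g c q 1 2)\<^sup>2 = 0"
    have "axis 1 1 \<noteq> (0 :: real ^ 2)" by (simp add: axis_eq_0_iff)
    from pos[OF q this] have a: "g c q 1 1 > 0" by (simp add: sum_2 axis_def)
    \<comment> \<open>The metric takes the value \<open>g c q 1 1 * det g\<close> on this vector, so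
      positivity gives a positive determinant.\<close>
    let ?v = "vector [g c q 1 2, - g c q 1 1] :: real ^ 2"
    have "?v \<noteq> 0" using a by (auto simp: vec_eq_iff forall_2 vector_2)
    from pos[OF q this] have "g c q 1 1 * (g c q 1 1 * g c q 2 2 - (g c q 1 2)\<^sup>2) > 0"
      using sym[OF q, of 2 1] by (simp add: sum_2 vector_2 power2_eq_square algebra_simps)
    then show False unfolding det0 by simp
  qed
  show ?thesis
  proof
    show "smooth_in c (\<lambda>q. kahler_form g J c q i j)" for i j
      unfolding kahler_form_def using g J by auto
    show "smooth_in c (\<lambda>q. D c q i j k)" for i j k
      using D c unfolding levi_civita_def affine_connection_def by blast
    show "D c q i j k = D c q j i k" if "q \<in> fst c" for q i j k
      using D c that unfolding levi_civita_def torsion_free_def by blast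
    show "cov_ll D g c q i j k = 0" if "q \<in> fst c" for q i j k
      using D c that unfolding levi_civita_def by blast
  qed (fact g sym Om det)+
qed

lemma harmonic_surface_chart_kahler:
  fixes A :: "('a, 2) chart set"
  assumes "smooth_manifold M A" "kahler_structure A g J" "levi_civita A g D"
    and X: "harmonic_one_form A g D X" and c: "c \<in> A"
  shows "harmonic_surface_chart c g (kahler_form g J) D X"
proof -
  interpret metric_surface_chart c g "kahler_form g J" D
    by (rule metric_surface_chart_kahler[OF assms(1-3) c])
  show ?thesis
  proof
    show "smooth_in c (\<lambda>q. X c q i)" for i
      using X c unfolding harmonic_one_form_def one_form_def by blast
    show "cov_l D X c q i j = cov_l D X c q j i" if "q \<in> fst c" for q i j
    proof -
      have "1/2 * (cov_l D X c q i j - cov_l D X c q j i) = 0"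
        using X c that unfolding harmonic_one_form_def by blast
      then show ?thesis by simp
    qed
    show "(\<Sum>i\<in>UNIV. \<Sum>j\<in>UNIV. inv_metric g c q i j * cov_l D X c q i j) = 0" if "q \<in> fst c" for q
      using X c that unfolding harmonic_one_form_def by blast
  qed
qed

text \<open>\<open>Om\<close> scales by the determinant of the Jacobian, so \<open>w\<close> scales
  by that of the inverse Jacobian. Multiplied into the Jacobian on the last index, this gives an
  adjugate, and the exchange of indices in \<open>Q_eq\<close> makes it the Jacobian of an upper
  index.\<close>

lemma raise_last_three_sym_transform:
  fixes A :: "('a, 2) chart set"
  assumes M: "smooth_manifold M A" and K: "kahler_structure A g J" and D: "levi_civita A g D"
    and X: "harmonic_one_form A g D X" and c: "c \<in> A" and d: "d \<in> A" and p: "p \<in> fst c \<inter> fst d"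
  defines "Q \<equiv> raise_last (kahler_form g J) (three_sym X g)"
  shows "Q d p i j k = (\<Sum>e\<in>UNIV. jac c d p e k * (\<Sum>a\<in>UNIV. \<Sum>b\<in>UNIV. jac d c p i a * jac d c p j b * Q c p a b e))"
proof -
  interpret c: harmonic_surface_chart c g "kahler_form g J" D X
    by (rule harmonic_surface_chart_kahler[OF M K D X c])
  interpret d: harmonic_surface_chart d g "kahler_form g J" D X
    by (rule harmonic_surface_chart_kahler[OF M K D X d])
  have g: "bilinear_form_field A g" and J: "endomorphism_field A J" and X1: "one_form A X"
    using K X unfolding kahler_structure_def riemannian_metric_def complex_structure_def harmonic_one_form_def
    by blast+
  have pc: "p \<in> fst c" and pd: "p \<in> fst d" using p by auto
  let ?P = "jac d c p" and ?Q = "jac c d p"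
  let ?detP = "?P 1 1 * ?P 2 2 - ?P 1 2 * ?P 2 1" and ?detQ = "?Q 1 1 * ?Q 2 2 - ?Q 1 2 * ?Q 2 1"
  note QP = jac_inverse[OF M c d p, unfolded sum_2]
  note PQ = inverse_2x2_entries[OF QP[of 1 1, simplified] QP[of 1 2, simplified]
    QP[of 2 1, simplified] QP[of 2 2, simplified]]
  have "kahler_form g J d p 1 2 = ?detP * kahler_form g J c p 1 2"
    unfolding kahler_form_transform[OF M g J c d p, of 1 2] sum_2
    using c.Om_skew[OF pc, of 2 1] pc by (simp add: algebra_simps)
  then have "d.w p = inverse ?detP * c.w p"
    unfolding d.w_def c.w_def by simp
  also have "inverse ?detP = ?detQ" using PQ(1) by (rule inverse_unique)
  finally have w: "d.w p = ?detQ * c.w p" .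
  \<comment> \<open>The first two indices are already in the chart \<open>d\<close>, the last one is
    still in \<open>c\<close>.\<close>
  define t where "t e = (\<Sum>a\<in>UNIV. \<Sum>b\<in>UNIV. ?P i a * ?P j b * three_sym X g c p a b e)" for e
  have P: "three_sym X g d p i j k = ?P k 1 * t 1 + ?P k 2 * t 2" for k
    unfolding three_sym_transform[OF g X1 c d p] sum_2[of "\<lambda>e. ?P k e * _ e"] t_def ..
  have tQ: "(\<Sum>a\<in>UNIV. \<Sum>b\<in>UNIV. ?P i a * ?P j b * Q c p a b 1) = c.w p * t 2"
    "(\<Sum>a\<in>UNIV. \<Sum>b\<in>UNIV. ?P i a * ?P j b * Q c p a b 2) = - (c.w p * t 1)"
    unfolding Q_def c.Q_eq[OF pc] t_def sum_2 by (simp_all add: algebra_simps)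
  have "Q d p i j 1 = c.w p * ((?detQ * ?P 2 1) * t 1 + (?detQ * ?P 2 2) * t 2)"
    unfolding Q_def d.Q_eq[OF pd] P w by (simp add: algebra_simps)
  then have "Q d p i j 1 = ?Q 1 1 * (c.w p * t 2) + ?Q 2 1 * - (c.w p * t 1)"
    unfolding PQ(2,3) by (simp add: algebra_simps)
  moreover have "Q d p i j 2 = - (c.w p * ((?detQ * ?P 1 1) * t 1 + (?detQ * ?P 1 2) * t 2))"
    unfolding Q_def d.Q_eq[OF pd] P w by (simp add: algebra_simps)
  then have "Q d p i j 2 = ?Q 1 2 * (c.w p * t 2) + ?Q 2 2 * - (c.w p * t 1)"
    unfolding PQ(4,5) by (simp add: algebra_simps)
  ultimately have "\<forall>k. Q d p i j k = ?Q 1 k * (c.w p * t 2) + ?Q 2 k * - (c.w p * t 1)"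
    unfolding forall_2 by blast
  then show ?thesis
    unfolding sum_2[of "\<lambda>e. jac c d p e k * _ e"] tQ by blast
qed

theorem theorem8p6:
  fixes M :: "'a topology"
    and A :: "('a, 2) chart set"
    and g J Om :: "('a, 2) tensor2"
    and D nabla :: "('a, 2) connection"
    and X :: "('a, 2) tensor1"
  assumes "smooth_manifold M A"
    and "kahler_structure A g J"
    and "levi_civita A g D"
    and "harmonic_one_form A g D X"
    and "\<exists>c\<in>A. \<exists>p\<in>fst c. \<exists>i. X c p i \<noteq> 0"
  defines "Om \<equiv> kahler_form g J"
    and "nabla \<equiv> \<lambda>c p i j k. D c p i j k + raise_last Om (three_sym X g) c p i j k"
  shows "symplectic_connection A Om nabla \<and>
    (\<forall>c\<in>A. \<forall>p\<in>fst c. \<forall>i.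
       rho Om nabla c p i = rho Om D c p i - 6 * scalar_curv g D c p * X c p i) \<and>
    ((\<exists>k. \<forall>c\<in>A. \<forall>p\<in>fst c. scalar_curv g D c p = k) \<longrightarrow>
       (\<forall>c\<in>A. \<forall>p\<in>fst c.
          (\<forall>i. rho Om nabla c p i = - 6 * scalar_curv g D c p * X c p i) \<and>
          calK Om nabla c p = 0))"
proof (intro conjI impI ballI allI)
  have chart: "harmonic_surface_chart c g Om D X" if "c \<in> A" for c
    unfolding Om_def by (rule harmonic_surface_chart_kahler[OF assms(1-4) that])
  show rho: "rho Om nabla c p i = rho Om D c p i - 6 * scalar_curv g D c p * X c p i"
    if "c \<in> A" "p \<in> fst c" for c p i
    unfolding nabla_def by (rule harmonic_surface_chart.rho_nabla[OF chart[OF that(1)] that(2)])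
  show "symplectic_connection A Om nabla"
    unfolding symplectic_connection_def affine_connection_def torsion_free_def
  proof (intro conjI ballI allI)
    fix c d p i j k assume c: "c \<in> A" and d: "d \<in> A" and p: "p \<in> fst c \<inter> fst d"
    have "D d p i j k = (\<Sum>e\<in>UNIV. jac c d p e k * (pd d i (\<lambda>q. jac d c q j e) p +
              (\<Sum>a\<in>UNIV. \<Sum>b\<in>UNIV. jac d c p i a * jac d c p j b * D c p a b e)))"
      using assms(3) c d p unfolding levi_civita_def affine_connection_def by blast
    \<comment> \<open>The second-derivative term belongs to \<open>D\<close> alone; the difference
      tensor adds a homogeneous law.\<close>
    with raise_last_three_sym_transform[OF assms(1-4) c d p, of i j k]
    show "nabla d p i j k = (\<Sum>e\<in>UNIV. jac c d p e k * (pd d i (\<lambda>q. jac d c q j e) p +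
              (\<Sum>a\<in>UNIV. \<Sum>b\<in>UNIV. jac d c p i a * jac d c p j b * nabla c p a b e)))"
      unfolding nabla_def Om_def by (simp only: distrib_left sum.distrib add.assoc)
  next
    fix c i j k assume "c \<in> A"
    then interpret harmonic_surface_chart c g Om D X by (rule chart)
    show "smooth_in c (\<lambda>p. nabla c p i j k)" unfolding nabla_def by simp
    show "nabla c p i j k = nabla c p j i k" if "p \<in> fst c" for p
      unfolding nabla_def D_sym[OF that, of i j] Q_sym[OF that, of i j] ..
    show "cov_ll nabla Om c p i j k = 0" if "p \<in> fst c" for p
      unfolding nabla_def by (rule Om_parallel_nabla[OF that])
  qed
  fix c p i assume "\<exists>k. \<forall>c\<in>A. \<forall>p\<in>fst c. scalar_curv g D c p = k" and c: "c \<in> A" and p: "p \<in> fst c"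
  then obtain k where k: "\<And>q. q \<in> fst c \<Longrightarrow> scalar_curv g D c q = k" by blast
  interpret harmonic_surface_chart c g Om D X by (rule chart[OF c])
  show "rho Om nabla c p i = - 6 * scalar_curv g D c p * X c p i"
    using rho[OF c p] rho_D[OF p] pd_scalar_curv_const[OF p k] by simp
  show "calK Om nabla c p = 0"
    unfolding nabla_def by (rule calK_nabla[OF p k])
qed

end
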